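(* Let $A\subseteq \mathrm{Ag}$, let $x\in\{D,T,B,4,5\}$ be a frame condition, and let $\mathsf{L}_1,\mathsf{L}_2$ be multi-agent logics without recursion operators such that $\mathsf{L}_1(\alpha)=\mathsf{L}_2(\alpha)+x$ when $\alpha\in A$ and $\mathsf{L}_1(\alpha)=\mathsf{L}_2(\alpha)$ otherwise, and $\mathsf{L}_2(\alpha)$ only includes frame conditions that precede $x$ in the fixed order $D,T,B,4,5$. For every formula $\varphi$ (without fixed-point operators), let $d=md(\varphi)$ if $x\neq 4$ and $d=md(\varphi)\cdot|\varphi|$ if $x=4$, and define $$\tau(\varphi)=\varphi\wedge Inv_d\Big(\bigwedge_{\psi\in\overline{\mathsf{sub}}(\varphi),\ \alpha\in A}\mathsf{ax}^x_\alpha[\psi/p]\Big).$$ Then $\varphi$ is $\mathsf{L}_1$-satisfiable if and only if $\tau(\varphi)$ is $\mathsf{L}_2$-satisfiable.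
   Context: Formulas (without recursion) are built from the grammar $\varphi::= p\mid\neg p\mid \mathtt{tt}\mid\mathtt{ff}\mid \varphi\wedge\varphi\mid\varphi\vee\varphi\mid\langle\alpha\rangle\varphi\mid[\alpha]\varphi$, where $p$ ranges over a finite set of propositional variables and $\alpha$ over a finite set $\mathrm{Ag}$ of agents. Negation $\neg\varphi$ of an arbitrary formula is defined by dualization (De Morgan laws, swapping $[\alpha]$ and $\langle\alpha\rangle$, $\mathtt{tt}$ and $\mathtt{ff}$), and $\varphi\to\psi$ abbreviates $\neg\varphi\vee\psi$. A Kripke model is $M=(W,R,V)$ with $W$ nonempty, $R\subseteq W\times\mathrm{Ag}\times W$ (write $R_\alpha$ for the $\alpha$-relation) and $V:W\to 2^{\mathrm{PVar}}$; $[\alpha]\varphi$ holds at $s$ iff $\varphi$ holds at all $R_\alpha$-successors of $s$, and $\langle\alpha\rangle\varphi$ iff at some $R_\alpha$-successor; the other connectives are as usual. Frame conditions on a relation: $D$ serial, $T$ reflexive, $B$ symmetric, $4$ transitive, $5$ euclidean. A single-agent logic is $\mathsf{K}$ plus a set of these conditions; $\mathsf{L}+c$ adds condition $c$. A multi-agent logic $\mathsf{L}$ on $\mathrm{Ag}$ assigns to each agent $\alpha$ a single-agent logic $\mathsf{L}(\alpha)$; its models are the Kripke models in which each $R_\alpha$ satisfies all conditions of $\mathsf{L}(\alpha)$. A formula is $\mathsf{L}$-satisfiable if it is true at some state of some model of $\mathsf{L}$. The modal depth $md$ is defined by $md(p)=md(\neg p)=md(\mathtt{tt})=md(\mathtt{ff})=0$,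 $md(\varphi\wedge\psi)=md(\varphi\vee\psi)=\max(md(\varphi),md(\psi))$, $md([\alpha]\varphi)=md(\langle\alpha\rangle\varphi)=1+md(\varphi)$. $\mathsf{sub}(\varphi)$ is the set of subformulas of $\varphi$, $|\varphi|=|\mathsf{sub}(\varphi)|$, and $\overline{\mathsf{sub}}(\varphi)=\mathsf{sub}(\varphi)\cup\{\neg\psi:\psi\in\mathsf{sub}(\varphi)\}$. $[\mathrm{Ag}]\chi$ abbreviates $\bigwedge_{\alpha\in\mathrm{Ag}}[\alpha]\chi$, $[\mathrm{Ag}]^i$ is its $i$-fold iteration, and $Inv_d(\chi)=\bigwedge_{i\le d}[\mathrm{Ag}]^i\chi$. The axioms are: $\mathsf{ax}^D_\alpha=\langle\alpha\rangle\mathtt{tt}$, $\mathsf{ax}^T_\alpha=[\alpha]p\to p$, $\mathsf{ax}^B_\alpha=\langle\alpha\rangle[\alpha]p\to p$, $\mathsf{ax}^4_\alpha=[\alpha]p\to[\alpha][\alpha]p$, $\mathsf{ax}^5_\alpha=\langle\alpha\rangle[\alpha]p\to[\alpha]p$, and $\mathsf{ax}^x_\alpha[\psi/p]$ denotes substitution of $\psi$ for $p$. *)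

theory Defs
  imports Main
begin

(* Formulas are in negation normal form: negation occurs only in literals. *)
datatype ('p, 'a) formula =
    Prop 'p
  | NegProp 'p
  | TT
  | FF
  | And "('p, 'a) formula" "('p, 'a) formula"
  | Or "('p, 'a) formula" "('p, 'a) formula"
  | Dia 'a "('p, 'a) formula"
  | Box 'a "('p, 'a) formula"

primrec neg :: "('p, 'a) formula \<Rightarrow> ('p, 'a) formula" where
  "neg (Prop p) = NegProp p"
| "neg (NegProp p) = Prop p"
| "neg TT = FF"
| "neg FF = TT"
| "neg (And \<phi> \<psi>) = Or (neg \<phi>) (neg \<psi>)"
| "neg (Or \<phi> \<psi>) = And (neg \<phi>) (neg \<psi>)"
| "neg (Dia \<alpha> \<phi>) = Box \<alpha> (neg \<phi>)"
| "neg (Box \<alpha> \<phi>) = Dia \<alpha> (neg \<phi>)"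

definition Imp :: "('p, 'a) formula \<Rightarrow> ('p, 'a) formula \<Rightarrow> ('p, 'a) formula" where
  "Imp \<phi> \<psi> = Or (neg \<phi>) \<psi>"

primrec md :: "('p, 'a) formula \<Rightarrow> nat" where
  "md (Prop p) = 0"
| "md (NegProp p) = 0"
| "md TT = 0"
| "md FF = 0"
| "md (And \<phi> \<psi>) = max (md \<phi>) (md \<psi>)"
| "md (Or \<phi> \<psi>) = max (md \<phi>) (md \<psi>)"
| "md (Dia \<alpha> \<phi>) = 1 + md \<phi>"
| "md (Box \<alpha> \<phi>) = 1 + md \<phi>"

(* A negative literal is atomic in the grammar, so its only subformula is itself. *)
primrec sub :: "('p, 'a) formula \<Rightarrow> ('p, 'a) formula set" where
  "sub (Prop p) = {Prop p}"
| "sub (NegProp p) = {NegProp p}"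
| "sub TT = {TT}"
| "sub FF = {FF}"
| "sub (And \<phi> \<psi>) = insert (And \<phi> \<psi>) (sub \<phi> \<union> sub \<psi>)"
| "sub (Or \<phi> \<psi>) = insert (Or \<phi> \<psi>) (sub \<phi> \<union> sub \<psi>)"
| "sub (Dia \<alpha> \<phi>) = insert (Dia \<alpha> \<phi>) (sub \<phi>)"
| "sub (Box \<alpha> \<phi>) = insert (Box \<alpha> \<phi>) (sub \<phi>)"

lemma finite_sub: "finite (sub \<phi>)"
  by (induction \<phi>) auto

definition sub_bar :: "('p, 'a) formula \<Rightarrow> ('p, 'a) formula set" where
  "sub_bar \<phi> = sub \<phi> \<union> neg ` sub \<phi>"

definition fsize :: "('p, 'a) formula \<Rightarrow> nat" where
  "fsize \<phi> = card (sub \<phi>)"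

primrec subst :: "'p \<Rightarrow> ('p, 'a) formula \<Rightarrow> ('p, 'a) formula \<Rightarrow> ('p, 'a) formula" where
  "subst p \<psi> (Prop q) = (if q = p then \<psi> else Prop q)"
| "subst p \<psi> (NegProp q) = (if q = p then neg \<psi> else NegProp q)"
| "subst p \<psi> TT = TT"
| "subst p \<psi> FF = FF"
| "subst p \<psi> (And \<phi> \<chi>) = And (subst p \<psi> \<phi>) (subst p \<psi> \<chi>)"
| "subst p \<psi> (Or \<phi> \<chi>) = Or (subst p \<psi> \<phi>) (subst p \<psi> \<chi>)"
| "subst p \<psi> (Dia \<alpha> \<phi>) = Dia \<alpha> (subst p \<psi> \<phi>)"
| "subst p \<psi> (Box \<alpha> \<phi>) = Box \<alpha> (subst p \<psi> \<phi>)"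

(* Conjunction of the family f over the finite index set I, in some unspecified order;
   the empty conjunction is TT. Meaningless for infinite I. *)
definition Conj :: "'i set \<Rightarrow> ('i \<Rightarrow> ('p, 'a) formula) \<Rightarrow> ('p, 'a) formula" where
  "Conj I f = foldr (\<lambda>i \<chi>. And (f i) \<chi>) (SOME is. set is = I \<and> distinct is) TT"

(* The agents are the elements of the type 'a. *)
definition BoxAg :: "('p, 'a::finite) formula \<Rightarrow> ('p, 'a) formula" where
  "BoxAg \<chi> = Conj UNIV (\<lambda>\<alpha>. Box \<alpha> \<chi>)"

definition Inv :: "nat \<Rightarrow> ('p, 'a::finite) formula \<Rightarrow> ('p, 'a) formula" where
  "Inv d \<chi> = Conj {..d} (\<lambda>i. (BoxAg ^^ i) \<chi>)"

record ('w, 'a, 'p) kripke =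
  worlds :: "'w set"
  rel :: "('w \<times> 'a \<times> 'w) set"
  val :: "'w \<Rightarrow> 'p set"

definition kripke_model :: "('w, 'a, 'p) kripke \<Rightarrow> bool" where
  "kripke_model M \<longleftrightarrow> worlds M \<noteq> {} \<and> rel M \<subseteq> worlds M \<times> UNIV \<times> worlds M"

definition acc :: "('w, 'a, 'p) kripke \<Rightarrow> 'a \<Rightarrow> 'w rel" where
  "acc M \<alpha> = {(s, t). (s, \<alpha>, t) \<in> rel M}"

primrec holds :: "('w, 'a, 'p) kripke \<Rightarrow> 'w \<Rightarrow> ('p, 'a) formula \<Rightarrow> bool" where
  "holds M s (Prop p) \<longleftrightarrow> p \<in> val M s"
| "holds M s (NegProp p) \<longleftrightarrow> p \<notin> val M s"
| "holds M s TT \<longleftrightarrow> True"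
| "holds M s FF \<longleftrightarrow> False"
| "holds M s (And \<phi> \<psi>) \<longleftrightarrow> holds M s \<phi> \<and> holds M s \<psi>"
| "holds M s (Or \<phi> \<psi>) \<longleftrightarrow> holds M s \<phi> \<or> holds M s \<psi>"
| "holds M s (Dia \<alpha> \<phi>) \<longleftrightarrow> (\<exists>t. (s, t) \<in> acc M \<alpha> \<and> holds M t \<phi>)"
| "holds M s (Box \<alpha> \<phi>) \<longleftrightarrow> (\<forall>t. (s, t) \<in> acc M \<alpha> \<longrightarrow> holds M t \<phi>)"

lemma holds_Conj:
  assumes "finite I"
  shows "holds M s (Conj I f) \<longleftrightarrow> (\<forall>i\<in>I. holds M s (f i))"
proof -
  have "set (SOME is. set is = I \<and> distinct is) = I"
    using someI_ex[OF finite_distinct_list[OF assms]] by blast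
  moreover have "holds M s (foldr (\<lambda>i \<chi>. And (f i) \<chi>) is TT) \<longleftrightarrow> (\<forall>i\<in>set is. holds M s (f i))" for "is"
    by (induction "is") auto
  ultimately show ?thesis
    by (simp add: Conj_def)
qed

datatype frame_cond = Cond_D | Cond_T | Cond_B | Cond_4 | Cond_5

primrec frame_cond_pos :: "frame_cond \<Rightarrow> nat" where
  "frame_cond_pos Cond_D = 0"
| "frame_cond_pos Cond_T = 1"
| "frame_cond_pos Cond_B = 2"
| "frame_cond_pos Cond_4 = 3"
| "frame_cond_pos Cond_5 = 4"

definition precedes :: "frame_cond \<Rightarrow> frame_cond \<Rightarrow> bool" where
  "precedes c x \<longleftrightarrow> frame_cond_pos c < frame_cond_pos x"

primrec satisfies_cond :: "'w set \<Rightarrow> 'w rel \<Rightarrow> frame_cond \<Rightarrow> bool" where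
  "satisfies_cond W r Cond_D \<longleftrightarrow> (\<forall>s\<in>W. \<exists>t\<in>W. (s, t) \<in> r)"
| "satisfies_cond W r Cond_T \<longleftrightarrow> refl_on W r"
| "satisfies_cond W r Cond_B \<longleftrightarrow> sym r"
| "satisfies_cond W r Cond_4 \<longleftrightarrow> trans r"
| "satisfies_cond W r Cond_5 \<longleftrightarrow> (\<forall>s t u. (s, t) \<in> r \<longrightarrow> (s, u) \<in> r \<longrightarrow> (t, u) \<in> r)"

(* A single-agent logic is K plus a set of frame conditions and is represented by that set;
   L + c is insert c L. *)
type_synonym single_logic = "frame_cond set"
type_synonym 'a logic = "'a \<Rightarrow> single_logic"

definition model_of :: "'a logic \<Rightarrow> ('w, 'a, 'p) kripke \<Rightarrow> bool" where
  "model_of L M \<longleftrightarrow>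
     kripke_model M \<and> (\<forall>\<alpha>. \<forall>c\<in>L \<alpha>. satisfies_cond (worlds M) (acc M \<alpha>) c)"

(* HOL cannot quantify existentially over types, so the type 'w from which the set of
   worlds is drawn is a parameter. The set of worlds itself is an arbitrary nonempty
   subset of 'w. By satisfiable_inj below, satisfiability over some type is equivalent to
   satisfiability over some infinite type. *)
definition satisfiable :: "'w itself \<Rightarrow> 'a logic \<Rightarrow> ('p, 'a) formula \<Rightarrow> bool" where
  "satisfiable _ L \<phi> \<longleftrightarrow>
     (\<exists>M :: ('w, 'a, 'p) kripke. model_of L M \<and> (\<exists>s\<in>worlds M. holds M s \<phi>))"

lemma satisfiable_inj:
  fixes f :: "'u \<Rightarrow> 'w"
  assumes "inj f" and "satisfiable TYPE('u) L \<phi>"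
  shows "satisfiable TYPE('w) L \<phi>"
proof -
  from assms(2) obtain M :: "('u, 'a, 'b) kripke" and s
    where M: "model_of L M" "s \<in> worlds M" "holds M s \<phi>"
    unfolding satisfiable_def by blast
  have f: "f u = f v \<longleftrightarrow> u = v" for u v
    using assms(1) by (auto dest: injD)
  have r: "(y, z) \<in> map_prod f f ` r \<longleftrightarrow> (\<exists>u v. y = f u \<and> z = f v \<and> (u, v) \<in> r)" for r y z
    by auto
  define N :: "('w, 'a, 'b) kripke" where
    "N = \<lparr>worlds = f ` worlds M, rel = (\<lambda>(u, \<alpha>, v). (f u, \<alpha>, f v)) ` rel M,
          val = val M \<circ> inv f\<rparr>"
  have worlds_N: "worlds N = f ` worlds M"
    by (simp add: N_def)
  have acc_N: "acc N \<alpha> = map_prod f f ` acc M \<alpha>" for \<alpha>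
    by (force simp: N_def acc_def image_iff)
  have acc_iff: "(f u, t) \<in> acc N \<alpha> \<longleftrightarrow> (\<exists>v. t = f v \<and> (u, v) \<in> acc M \<alpha>)" for u t \<alpha>
    by (auto simp: acc_N r f)
  have holds_N: "holds N (f u) \<chi> \<longleftrightarrow> holds M u \<chi>" for u \<chi>
  proof (induction \<chi> arbitrary: u)
    case (Prop p)
    show ?case using assms(1) by (simp add: N_def)
  next
    case (NegProp p)
    show ?case using assms(1) by (simp add: N_def)
  qed (auto simp: acc_iff)
  have cond_N: "satisfies_cond (f ` W) (map_prod f f ` r) c" if "satisfies_cond W r c" for W r c
  proof -
    show ?thesis
    proof (cases c)
      case Cond_D
      with that show ?thesis by (simp add: r f)
    next
      case Cond_T
      with that show ?thesis by (auto simp: refl_on_def r f)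
    next
      case Cond_B
      with that show ?thesis unfolding Cond_B satisfies_cond.simps sym_def r by (metis f)
    next
      case Cond_4
      with that show ?thesis unfolding Cond_4 satisfies_cond.simps trans_def r by (metis f)
    next
      case Cond_5
      with that show ?thesis unfolding Cond_5 satisfies_cond.simps r by (metis f)
    qed
  qed
  have "kripke_model N"
    using M(1) by (force simp: model_of_def kripke_model_def N_def)
  hence "model_of L N"
    using M(1) cond_N by (simp add: model_of_def worlds_N acc_N)
  moreover have "f s \<in> worlds N" "holds N (f s) \<phi>"
    using M by (auto simp: worlds_N holds_N)
  ultimately show ?thesis
    unfolding satisfiable_def by blast
qed

primrec ax :: "frame_cond \<Rightarrow> 'a \<Rightarrow> 'p \<Rightarrow> ('p, 'a) formula" where
  "ax Cond_D \<alpha> p = Dia \<alpha> TT"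
| "ax Cond_T \<alpha> p = Imp (Box \<alpha> (Prop p)) (Prop p)"
| "ax Cond_B \<alpha> p = Imp (Dia \<alpha> (Box \<alpha> (Prop p))) (Prop p)"
| "ax Cond_4 \<alpha> p = Imp (Box \<alpha> (Prop p)) (Box \<alpha> (Box \<alpha> (Prop p)))"
| "ax Cond_5 \<alpha> p = Imp (Dia \<alpha> (Box \<alpha> (Prop p))) (Box \<alpha> (Prop p))"

definition tau_depth :: "frame_cond \<Rightarrow> ('p, 'a) formula \<Rightarrow> nat" where
  "tau_depth x \<phi> = (if x = Cond_4 then md \<phi> * fsize \<phi> else md \<phi>)"

(* p is the propositional variable in which the axioms are written; since it is substituted
   away, the result does not depend on it. *)
definition tau ::
    "'p \<Rightarrow> 'a set \<Rightarrow> frame_cond \<Rightarrow> ('p, 'a::finite) formula \<Rightarrow> ('p, 'a) formula" where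
  "tau p A x \<phi> =
     And \<phi> (Inv (tau_depth x \<phi>)
       (Conj (sub_bar \<phi> \<times> A) (\<lambda>(\<psi>, \<alpha>). subst p \<psi> (ax x \<alpha> p))))"

end

theory Submission
  imports Defs
begin

text \<open>
  Axioms are valid on their frames, so only the direction from \<open>L2\<close> to \<open>L1\<close> needs work. A model
  of the translation is rebuilt as a tree of \<^emph>\<open>components\<close>: every node \<open>y\<close> is, for each agent other
  than the one along which it was reached, the root of a component, a frame for that agent's
  \<open>L1\<close>-conditions whose points are worlds of the given model. Distinct components of one agent are
  disjoint, so the tree inherits the frame conditions. Each node carries a rank bounding the
  modal depth of the formulas it must satisfy, and moving inside a component costs rank; a node
  of rank \<open>0\<close> only needs a reflexive point, and the axioms are available at every node of positive
  rank. As formulas are in negation normal form, it suffices that truth is preserved, not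
  reflected.

  Components exist for the following reasons. For \<open>D\<close>, \<open>T\<close>, \<open>B\<close> one unravels the agent's relation
  into layers and adds loops and converse edges. For \<open>4\<close> one takes the relation of Lemmon's
  filtration, which is transitive by construction, on the worlds reached by paths along which
  the set of true boxes grows strictly except perhaps in the last step: their length is at most
  the number of subformulas, which is the reason for the factor in the depth. For \<open>5\<close> the component is a
  root together with a universal cluster of worlds at distance one or two; this also serves for \<open>4\<close>
  in the presence of \<open>B\<close>.
\<close>

section \<open>Formulas and axioms\<close>

lemma neg_neg [simp]: "neg (neg \<phi>) = \<phi>"
  by (induction \<phi>) auto

lemma holds_neg [simp]: "holds M s (neg \<phi>) \<longleftrightarrow> \<not> holds M s \<phi>"
  by (induction \<phi> arbitrary: s) auto

lemma sub_refl: "\<phi> \<in> sub \<phi>"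
  by (cases \<phi>) auto

lemma sub_trans: "\<psi> \<in> sub \<chi> \<Longrightarrow> \<chi> \<in> sub \<phi> \<Longrightarrow> \<psi> \<in> sub \<phi>"
  by (induction \<phi>) auto

lemma sub_modal:
  assumes "Dia \<alpha> \<chi> \<in> sub \<phi> \<or> Box \<alpha> \<chi> \<in> sub \<phi>"
  shows "\<chi> \<in> sub \<phi>"
proof -
  have "\<chi> \<in> sub (Dia \<alpha> \<chi>)" "\<chi> \<in> sub (Box \<alpha> \<chi>)"
    by (simp_all add: sub_refl)
  then show ?thesis
    using assms sub_trans by blast
qed

text \<open>Makes the modal subformulas a proper part of \<open>sub \<phi>\<close>. This strictness
  leaves room for one more step after a longest chain of growing sets of boxes.\<close>

lemma sub_atomic: "\<exists>\<chi>\<in>sub \<phi>. \<forall>\<alpha> \<psi>. \<chi> \<noteq> Dia \<alpha> \<psi> \<and> \<chi> \<noteq> Box \<alpha> \<psi>"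
proof (induction \<phi>)
  case (And \<phi> \<psi>)
  then show ?case unfolding sub.simps by blast
next
  case (Or \<phi> \<psi>)
  then show ?case unfolding sub.simps by blast
next
  case (Dia \<alpha> \<phi>)
  then show ?case unfolding sub.simps by blast
next
  case (Box \<alpha> \<phi>)
  then show ?case unfolding sub.simps by blast
qed simp_all

lemma neg_sub_bar: "\<psi> \<in> sub_bar \<phi> \<Longrightarrow> neg \<psi> \<in> sub_bar \<phi>"
  by (auto simp: sub_bar_def)

lemma sub_bar_modal:
  assumes "Dia \<alpha> \<chi> \<in> sub \<phi> \<or> Box \<alpha> \<chi> \<in> sub \<phi>"
  shows "\<chi> \<in> sub_bar \<phi>" "neg \<chi> \<in> sub_bar \<phi>"
  using sub_modal[OF assms] by (auto simp: sub_bar_def)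

text \<open>The dual box of a diamond subformula is its negation. Thus axiom 5 has instances at
  boxes as well as at bodies of modal subformulas, as its dual form requires.\<close>

lemma sub_bar_Box:
  assumes "Dia \<alpha> (neg \<chi>) \<in> sub \<phi> \<or> Box \<alpha> \<chi> \<in> sub \<phi>"
  shows "Box \<alpha> \<chi> \<in> sub_bar \<phi>"
  using assms by (force simp: sub_bar_def image_iff)

lemma finite_sub_bar: "finite (sub_bar \<phi>)"
  by (simp add: sub_bar_def finite_sub)

section \<open>Iterated steps, the invariance formula and validity of the axioms\<close>

definition step :: "('w, 'a, 'p) kripke \<Rightarrow> 'w rel" where
  "step M = (\<Union>\<alpha>. acc M \<alpha>)"

lemma acc_step: "(u, v) \<in> acc M \<alpha> \<Longrightarrow> (u, v) \<in> step M"
  by (auto simp: step_def)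

lemma acc_pow_step: "(u, v) \<in> acc M \<alpha> ^^ i \<Longrightarrow> (u, v) \<in> step M ^^ i"
  by (induction i arbitrary: v) (auto dest: acc_step)

lemma holds_BoxAg: "holds M s (BoxAg \<chi>) \<longleftrightarrow> (\<forall>t. (s, t) \<in> step M \<longrightarrow> holds M t \<chi>)"
  by (auto simp: BoxAg_def holds_Conj step_def)

lemma holds_BoxAg_pow:
  "holds M s ((BoxAg ^^ i) \<chi>) \<longleftrightarrow> (\<forall>t. (s, t) \<in> step M ^^ i \<longrightarrow> holds M t \<chi>)"
proof (induction i arbitrary: s)
  case (Suc i)
  have "(s, t) \<in> step M ^^ Suc i \<longleftrightarrow> (\<exists>u. (s, u) \<in> step M \<and> (u, t) \<in> step M ^^ i)" for t
  proof -
    have "step M ^^ Suc i = step M O step M ^^ i"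
      by (simp add: relpow_commute)
    then show ?thesis by blast
  qed
  then show ?case
    using Suc by (auto simp: holds_BoxAg simp del: relpow.simps)
qed simp

lemma holds_Inv:
  "holds M s (Inv d \<chi>) \<longleftrightarrow> (\<forall>i\<le>d. \<forall>t. (s, t) \<in> step M ^^ i \<longrightarrow> holds M t \<chi>)"
  by (auto simp: Inv_def holds_Conj holds_BoxAg_pow)

lemma ax_valid:
  assumes "satisfies_cond (worlds M) (acc M \<alpha>) x" "s \<in> worlds M"
  shows "holds M s (subst p \<psi> (ax x \<alpha> p))"
proof (cases x)
  case Cond_D
  with assms show ?thesis by auto
next
  case Cond_T
  with assms show ?thesis by (auto simp: Imp_def refl_on_def)
next
  case Cond_B
  with assms show ?thesis by (auto simp: Imp_def dest: symD)
next
  case Cond_4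
  then have "trans (acc M \<alpha>)"
    using assms by simp
  then show ?thesis using Cond_4 by (auto simp: Imp_def dest: transD)
next
  case Cond_5
  show ?thesis unfolding Cond_5
    by (simp add: Imp_def) (use assms Cond_5 in \<open>unfold Cond_5 satisfies_cond.simps, blast\<close>)
qed

section \<open>Worlds of the given model around which enough axioms hold\<close>

locale reduction =
  fixes M :: "('w, 'a::finite, 'p) kripke"
    and A :: "'a set" and x :: frame_cond and L1 L2 :: "'a logic"
    and \<phi> :: "('p, 'a) formula" and p :: 'p
  assumes model: "model_of L2 M"
    and L1_in: "\<alpha> \<in> A \<Longrightarrow> L1 \<alpha> = insert x (L2 \<alpha>)"
    and L1_notin: "\<alpha> \<notin> A \<Longrightarrow> L1 \<alpha> = L2 \<alpha>"
    and prec: "c \<in> L2 \<alpha> \<Longrightarrow> precedes c x"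
begin

definition ax_sat :: "'w \<Rightarrow> bool" where
  "ax_sat u \<longleftrightarrow> (\<forall>\<psi>\<in>sub_bar \<phi>. \<forall>\<alpha>\<in>A. holds M u (subst p \<psi> (ax x \<alpha> p)))"

text \<open>The number of steps in \<open>M\<close> that one unit of rank pays for.\<close>
definition stride :: nat where
  "stride = (if x = Cond_4 then fsize \<phi> else 1)"

text \<open>At \<open>m = md \<phi>\<close> this is what the invariance part of \<open>tau\<close>
  says. Steps of all agents are counted, since a path in the tree to be built alternates between
  agents.\<close>

definition good :: "nat \<Rightarrow> 'w \<Rightarrow> bool" where
  "good m w \<longleftrightarrow> (\<forall>k\<le>m * stride. \<forall>u. (w, u) \<in> step M ^^ k \<longrightarrow> ax_sat u)"

lemma stride_pos: "stride \<ge> 1"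
proof -
  have "card (sub \<phi>) > 0"
    using sub_refl finite_sub by (auto simp: card_gt_0_iff)
  then show ?thesis
    by (simp add: stride_def fsize_def)
qed

lemma acc_worlds: "(u, v) \<in> acc M \<alpha> \<Longrightarrow> u \<in> worlds M \<and> v \<in> worlds M"
  using model by (auto simp: model_of_def kripke_model_def acc_def)

lemma acc_pow_worlds: "(u, v) \<in> acc M \<alpha> ^^ i \<Longrightarrow> u \<in> worlds M \<Longrightarrow> v \<in> worlds M"
  by (induction i arbitrary: v) (auto dest: acc_worlds)

lemma L2_cond: "c \<in> L2 \<alpha> \<Longrightarrow> satisfies_cond (worlds M) (acc M \<alpha>) c"
  using model by (auto simp: model_of_def)

lemma L2_serial: "Cond_D \<in> L2 \<alpha> \<Longrightarrow> u \<in> worlds M \<Longrightarrow> \<exists>v. (u, v) \<in> acc M \<alpha>"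
  using L2_cond[of Cond_D \<alpha>] by auto

lemma L2_refl: "Cond_T \<in> L2 \<alpha> \<Longrightarrow> u \<in> worlds M \<Longrightarrow> (u, u) \<in> acc M \<alpha>"
  using L2_cond[of Cond_T \<alpha>] by (simp add: refl_on_def)

lemma L2_sym: "Cond_B \<in> L2 \<alpha> \<Longrightarrow> (u, v) \<in> acc M \<alpha> \<Longrightarrow> (v, u) \<in> acc M \<alpha>"
  using L2_cond[of Cond_B \<alpha>] by (simp add: symD)

lemma L2_trans:
  "Cond_4 \<in> L2 \<alpha> \<Longrightarrow> (u, v) \<in> acc M \<alpha> \<Longrightarrow> (v, w) \<in> acc M \<alpha> \<Longrightarrow> (u, w) \<in> acc M \<alpha>"
  using L2_cond[of Cond_4 \<alpha>] by (auto dest: transD)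

lemma good_ax: "good m w \<Longrightarrow> (w, v) \<in> acc M \<alpha> ^^ k \<Longrightarrow> k \<le> m * stride \<Longrightarrow> ax_sat v"
  using acc_pow_step by (fastforce simp: good_def)

lemma good_ax_le:
  assumes "good m w" "(w, v) \<in> acc M \<alpha> ^^ k" "k \<le> m"
  shows "ax_sat v"
proof -
  have "m * 1 \<le> m * stride"
    using stride_pos by (rule mult_le_mono2)
  then show ?thesis
    using good_ax[OF assms(1,2)] assms(3) by linarith
qed

text \<open>Of a budget of \<open>m * stride\<close> steps, \<open>k\<close> are spent on reaching
  \<open>v\<close> and the rest covers \<open>j\<close> units. Counting in steps lets a path of up
  to \<open>fsize \<phi>\<close> steps cost a single unit for condition 4.\<close>

lemma good_far:
  assumes "good m w" "(w, v) \<in> acc M \<alpha> ^^ k" "k + j * stride \<le> m * stride"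
  shows "good j v"
  unfolding good_def
proof (intro allI impI)
  fix l u assume "l \<le> j * stride" "(v, u) \<in> step M ^^ l"
  then have "(w, u) \<in> step M ^^ (k + l)" "k + l \<le> m * stride"
    using assms(2,3) acc_pow_step[OF assms(2)] by (auto simp: relpow_add)
  then show "ax_sat u"
    using assms(1) by (auto simp: good_def)
qed

lemma good_near:
  assumes "good m w" "(w, v) \<in> acc M \<alpha> ^^ i" "i \<le> m"
  shows "good (m - i) v"
proof (rule good_far[OF assms(1,2)])
  have "i * 1 \<le> i * stride"
    using stride_pos by (rule mult_le_mono2)
  moreover have "m * stride = i * stride + (m - i) * stride"
    using assms(3) by (simp flip: add_mult_distrib)
  ultimately show "i + (m - i) * stride \<le> m * stride"
    by simp
qed

section \<open>Components\<close>

text \<open>A point \<open>(v, i)\<close> is a world together with the rank lost in reaching it from the root \<open>(w, 0)\<close>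
  of rank \<open>m\<close>. The last two conjuncts are the modal cases of the truth lemma; bounding
  \<open>md \<chi> + i'\<close> by \<open>m\<close> keeps the truncated subtraction \<open>m - i'\<close> harmless.\<close>
definition component :: "'a \<Rightarrow> 'w \<Rightarrow> nat \<Rightarrow> ('w \<times> nat) set \<Rightarrow> ('w \<times> nat) rel \<Rightarrow> bool" where
  "component \<alpha> w m E r \<longleftrightarrow>
     (w, 0) \<in> E \<and> (\<forall>v. (v, 0) \<in> E \<longrightarrow> v = w) \<and> fst ` E \<subseteq> worlds M \<and> r \<subseteq> E \<times> E \<and>
     (\<forall>c\<in>L1 \<alpha>. satisfies_cond E r c) \<and>
     (\<forall>v i. (v, i) \<in> E \<longrightarrow> i < m \<longrightarrow> good (m - i) v) \<and>
     (\<forall>v i \<chi>. (v, i) \<in> E \<longrightarrow> Dia \<alpha> \<chi> \<in> sub \<phi> \<longrightarrow> md \<chi> + i < m \<longrightarrow> holds M v (Dia \<alpha> \<chi>) \<longrightarrow>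
        (\<exists>v' i'. ((v, i), (v', i')) \<in> r \<and> holds M v' \<chi> \<and> md \<chi> + i' \<le> m)) \<and>
     (\<forall>v i v' i' \<chi>. ((v, i), (v', i')) \<in> r \<longrightarrow> Box \<alpha> \<chi> \<in> sub \<phi> \<longrightarrow> md \<chi> + i < m \<longrightarrow>
        holds M v (Box \<alpha> \<chi>) \<longrightarrow> holds M v' \<chi> \<and> md \<chi> + i' \<le> m)"

text \<open>At rank 0 the clauses on goodness and truth are vacuous, and a single reflexive point
  satisfies all five frame conditions.\<close>

lemma component_trivial:
  assumes "w \<in> worlds M"
  shows "component \<alpha> w 0 {(w, 0)} {((w, 0), (w, 0))}"
proof -
  have "satisfies_cond {(w, 0)} {((w, 0), (w, 0))} c" for c
    by (cases c) (auto simp: refl_on_def sym_def trans_def)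
  then show ?thesis
    using assms by (auto simp: component_def)
qed

section \<open>Components for seriality, reflexivity and symmetry\<close>

lemma axD:
  assumes "x = Cond_D" "\<alpha> \<in> A" "ax_sat u"
  shows "\<exists>v. (u, v) \<in> acc M \<alpha>"
proof -
  \<comment> \<open>Axiom D contains no variable, but it occurs in the conjunction only if some
    formula indexes an instance.\<close>
  have "\<phi> \<in> sub_bar \<phi>"
    by (simp add: sub_bar_def sub_refl)
  then show ?thesis
    using assms unfolding ax_sat_def by fastforce
qed

lemma axT:
  assumes "x = Cond_T" "\<alpha> \<in> A" "ax_sat u" "\<psi> \<in> sub_bar \<phi>" "holds M u (Box \<alpha> \<psi>)"
  shows "holds M u \<psi>"
  using assms unfolding ax_sat_def by (fastforce simp: Imp_def)

lemma axB:
  assumes "x = Cond_B" "\<alpha> \<in> A" "ax_sat u" "\<psi> \<in> sub_bar \<phi>" "(u, v) \<in> acc M \<alpha>" "holds M v (Box \<alpha> \<psi>)"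
  shows "holds M u \<psi>"
  using assms unfolding ax_sat_def by (fastforce simp: Imp_def)

text \<open>Layer \<open>i\<close> holds the worlds at the end of a path of \<open>i\<close> steps,
  so a forward edge costs one unit, a loop nothing, and a converse edge regains one. Boxes are
  respected by converse edges and reflexive loops because of \<open>L2\<close> or of axiom
  \<open>x\<close>, which is available up to layer \<open>m\<close>; deeper layers carry no truth
  conditions.\<close>

lemma component_layered:
  assumes w: "w \<in> worlds M" and good: "good m w" and L: "L1 \<alpha> \<subseteq> {Cond_D, Cond_T, Cond_B}"
  shows "\<exists>E r. component \<alpha> w m E r"
proof -
  define E where "E = {(v, i). (w, v) \<in> acc M \<alpha> ^^ i}"
  define F where "F = {((u, i), (v, Suc i)) | u i v. (u, i) \<in> E \<and> (u, v) \<in> acc M \<alpha>}"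
  define r where "r = F \<union> {(e, e') \<in> F\<inverse>. Cond_B \<in> L1 \<alpha>} \<union> {(e, e'). e \<in> E \<and> e' = e \<and> Cond_T \<in> L1 \<alpha>}
     \<union> {(e, e'). e \<in> E \<and> e' = e \<and> Cond_D \<in> L1 \<alpha> \<and> (\<forall>v. (fst e, v) \<notin> acc M \<alpha>)}"
  have F: "F \<subseteq> E \<times> E"
    by (auto simp: F_def E_def)
  have EW: "v \<in> worlds M" if "(v, i) \<in> E" for v i
    using that w acc_pow_worlds by (auto simp: E_def)
  have ax: "ax_sat v" if "(v, i) \<in> E" "i \<le> m" for v i
    using good_ax_le[OF good] that by (auto simp: E_def)
  have new: "\<alpha> \<in> A \<and> c = x" if "c \<in> L1 \<alpha>" "c \<notin> L2 \<alpha>" for c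
    using that L1_in L1_notin by (cases "\<alpha> \<in> A") auto
  have "satisfies_cond E r c" if "c \<in> L1 \<alpha>" for c
  proof -
    have "c \<in> {Cond_D, Cond_T, Cond_B}"
      using that L by blast
    then consider "c = Cond_D" | "c = Cond_T" | "c = Cond_B"
      by auto
    then show ?thesis
    proof cases
      case 1
      have "\<exists>e'\<in>E. (e, e') \<in> r" if e: "e \<in> E" for e
      proof (cases "\<exists>v. (fst e, v) \<in> acc M \<alpha>")
        case True
        then obtain v where "(e, (v, Suc (snd e))) \<in> F"
          using e by (cases e) (auto simp: F_def)
        then show ?thesis using F by (auto simp: r_def)
      next
        case False
        then show ?thesis using e 1 that \<open>c \<in> L1 \<alpha>\<close> by (auto simp: r_def)
      qed
      then show ?thesis using 1 by simp
    next
      case 2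
      then show ?thesis using that F by (auto simp: refl_on_def r_def)
    next
      case 3
      then show ?thesis using that by (auto simp: sym_def r_def)
    qed
  qed
  moreover have "holds M v' \<chi> \<and> md \<chi> + i' \<le> m"
    if e: "((v, i), (v', i')) \<in> r" and \<chi>: "Box \<alpha> \<chi> \<in> sub \<phi>" "md \<chi> + i < m" "holds M v (Box \<alpha> \<chi>)"
    for v i v' i' \<chi>
  proof -
    have bar: "\<chi> \<in> sub_bar \<phi>"
      using \<chi>(1) by (intro sub_bar_modal(1)) blast
    from e consider "((v, i), (v', i')) \<in> F"
      | "((v', i'), (v, i)) \<in> F" "Cond_B \<in> L1 \<alpha>"
      | "(v, i) \<in> E" "v' = v" "i' = i" "Cond_T \<in> L1 \<alpha>"
      | "(v, i) \<in> E" "v' = v" "i' = i" "Cond_D \<in> L1 \<alpha>" "\<forall>u. (v, u) \<notin> acc M \<alpha>"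
      by (auto simp: r_def)
    then show ?thesis
    proof cases
      case 1
      then show ?thesis using \<chi> by (auto simp: F_def)
    next
      case 2
      then have i: "i = Suc i'" and E': "(v', i') \<in> E" and acc: "(v', v) \<in> acc M \<alpha>"
        by (auto simp: F_def)
      have "holds M v' \<chi>"
      proof (cases "Cond_B \<in> L2 \<alpha>")
        case True
        then show ?thesis using \<chi>(3) acc L2_sym by auto
      next
        case False
        then have "\<alpha> \<in> A" "x = Cond_B" using new 2 by auto
        moreover have "ax_sat v'" using ax[OF E'] \<chi>(2) i by simp
        ultimately show ?thesis
          using axB \<chi>(3) acc bar by blast
      qed
      then show ?thesis using \<chi>(2) i by simp
    next
      case 3
      have "holds M v \<chi>"
      proof (cases "Cond_T \<in> L2 \<alpha>")
        case True
        then show ?thesis using \<chi>(3) L2_refl EW 3 by auto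
      next
        case False
        then have "\<alpha> \<in> A" "x = Cond_T" using new 3 by auto
        moreover have "ax_sat v" using ax 3 \<chi>(2) by simp
        ultimately show ?thesis
          using axT \<chi>(3) bar by blast
      qed
      then show ?thesis using \<chi>(2) 3 by simp
    next
      case 4
      \<comment> \<open>Loops for D are placed only at dead ends, which seriality or axiom D
        excludes in layers below \<open>m\<close>.\<close>
      have False
      proof (cases "Cond_D \<in> L2 \<alpha>")
        case True
        then show ?thesis using L2_serial EW 4 by blast
      next
        case False
        then have "\<alpha> \<in> A" "x = Cond_D" using new 4 by auto
        moreover have "ax_sat v" using ax 4 \<chi>(2) by simp
        ultimately show ?thesis
          using axD 4 by blast
      qed
      then show ?thesis ..
    qed
  qed
  moreover have "\<exists>v' i'. ((v, i), (v', i')) \<in> r \<and> holds M v' \<chi> \<and> md \<chi> + i' \<le> m"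
    if v: "(v, i) \<in> E" "md \<chi> + i < m" "holds M v (Dia \<alpha> \<chi>)" for v i \<chi>
  proof -
    obtain v' where "(v, v') \<in> acc M \<alpha>" "holds M v' \<chi>"
      using v(3) by auto
    then show ?thesis
      using v by (intro exI[of _ v'] exI[of _ "Suc i"]) (auto simp: r_def F_def)
  qed
  moreover have "good (m - i) v" if "(v, i) \<in> E" "i < m" for v i
    using good_near[OF good] that by (auto simp: E_def)
  moreover have "r \<subseteq> E \<times> E"
    using F by (auto simp: r_def)
  moreover have "(w, 0) \<in> E" "\<forall>v. (v, 0) \<in> E \<longrightarrow> v = w" "fst ` E \<subseteq> worlds M"
    using EW by (auto simp: E_def)
  ultimately have "component \<alpha> w m E r"
    unfolding component_def by blast
  then show ?thesis by blast
qed

section \<open>Clusters, and components of agents already transitive\<close>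

lemma good_succ: "good m w \<Longrightarrow> (w, v) \<in> acc M \<alpha> \<Longrightarrow> m \<ge> 1 \<Longrightarrow> good (m - Suc 0) v"
  using good_near[where i = 1] by simp

lemma ax_sat_succ: "good m w \<Longrightarrow> (w, v) \<in> acc M \<alpha> \<Longrightarrow> m \<ge> 1 \<Longrightarrow> ax_sat v"
  using good_ax_le[where k = 1] by simp

lemma ax_sat_self: "good m w \<Longrightarrow> ax_sat w"
  using good_ax_le[where k = 0] by simp

text \<open>Every point sees exactly \<open>Y\<close>, the successors of the root together with the
  root itself if \<open>loop\<close> holds; such a relation is transitive and euclidean. As all
  points see the same ones, boxes and diamonds true at a successor must be true at the root: this is
  what \<open>box\<close> and \<open>dia\<close> provide, while \<open>root\<close> treats the root
  as a target.\<close>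

lemma component_cluster:
  assumes w: "w \<in> worlds M" and good: "good m w" and m: "m \<ge> 1"
    and box: "\<And>v \<psi>. (w, v) \<in> acc M \<alpha> \<Longrightarrow> Box \<alpha> \<psi> \<in> sub \<phi> \<Longrightarrow> holds M v (Box \<alpha> \<psi>) \<Longrightarrow>
        holds M w (Box \<alpha> \<psi>)"
    and dia: "\<And>v \<psi>. (w, v) \<in> acc M \<alpha> \<Longrightarrow> Dia \<alpha> \<psi> \<in> sub \<phi> \<Longrightarrow> holds M v (Dia \<alpha> \<psi>) \<Longrightarrow>
        holds M w (Dia \<alpha> \<psi>)"
    and root: "\<And>\<psi>. loop \<Longrightarrow> Box \<alpha> \<psi> \<in> sub \<phi> \<Longrightarrow> holds M w (Box \<alpha> \<psi>) \<Longrightarrow> holds M w \<psi>"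
    and D: "Cond_D \<in> L1 \<alpha> \<Longrightarrow> loop \<or> (\<exists>v. (w, v) \<in> acc M \<alpha>)"
    and T: "Cond_T \<in> L1 \<alpha> \<Longrightarrow> loop"
    and B: "Cond_B \<in> L1 \<alpha> \<Longrightarrow> loop \<or> (\<forall>v. (w, v) \<notin> acc M \<alpha>)"
  shows "\<exists>E r. component \<alpha> w m E r"
proof -
  define Y where "Y = {(v, Suc 0) | v. (w, v) \<in> acc M \<alpha>} \<union> {(v, i). v = w \<and> i = 0 \<and> loop}"
  define E where "E = insert (w, 0) Y"
  define r where "r = E \<times> Y"
  have "satisfies_cond E r c" if "c \<in> L1 \<alpha>" for c
  proof (cases c)
    case Cond_D
    then show ?thesis using that D by (fastforce simp: r_def E_def Y_def)
  next
    case Cond_T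
    then show ?thesis using that T by (auto simp: r_def E_def Y_def refl_on_def)
  next
    case Cond_B
    then show ?thesis using that B by (auto simp: r_def E_def Y_def sym_def)
  next
    case Cond_4
    then show ?thesis by (auto simp: r_def trans_def)
  next
    case Cond_5
    then show ?thesis by (auto simp: r_def E_def)
  qed
  moreover have "holds M v' \<chi> \<and> md \<chi> + i' \<le> m"
    if e: "((v, i), (v', i')) \<in> r" and \<chi>: "Box \<alpha> \<chi> \<in> sub \<phi>" "md \<chi> + i < m" "holds M v (Box \<alpha> \<chi>)"
    for v i v' i' \<chi>
  proof -
    have "holds M w (Box \<alpha> \<chi>)"
      using e \<chi> box by (auto simp: r_def E_def Y_def)
    then show ?thesis
      using e \<chi> root by (auto simp: r_def Y_def)
  qed
  moreover have "\<exists>v' i'. ((v, i), (v', i')) \<in> r \<and> holds M v' \<chi> \<and> md \<chi> + i' \<le> m"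
    if "(v, i) \<in> E" "Dia \<alpha> \<chi> \<in> sub \<phi>" "md \<chi> + i < m" "holds M v (Dia \<alpha> \<chi>)" for v i \<chi>
  proof -
    have "holds M w (Dia \<alpha> \<chi>)"
      using that dia by (auto simp: E_def Y_def)
    then obtain v' where "(w, v') \<in> acc M \<alpha>" "holds M v' \<chi>"
      by auto
    then show ?thesis
      using that by (intro exI[of _ v'] exI[of _ "Suc 0"]) (auto simp: r_def Y_def)
  qed
  moreover have "good (m - i) v" if "(v, i) \<in> E" "i < m" for v i
    using good good_succ[OF good] m that by (auto simp: E_def Y_def)
  moreover have "r \<subseteq> E \<times> E"
    by (auto simp: r_def E_def)
  moreover have "(w, 0) \<in> E" "\<forall>v. (v, 0) \<in> E \<longrightarrow> v = w" "fst ` E \<subseteq> worlds M"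
    using w by (auto simp: E_def Y_def dest: acc_worlds)
  ultimately have "component \<alpha> w m E r"
    unfolding component_def by blast
  then show ?thesis by blast
qed

text \<open>By transitivity everything reachable along \<alpha> is already a successor of the root.
  All these points can therefore be charged one unit, and the relation of \<open>M\<close> itself
  provides the frame conditions and truth.\<close>

lemma component_transitive:
  assumes w: "w \<in> worlds M" and good: "good m w" and m: "m \<ge> 1"
    and four: "Cond_4 \<in> L2 \<alpha>" and eq: "L1 \<alpha> = L2 \<alpha>"
  shows "\<exists>E r. component \<alpha> w m E r"
proof -
  define E where "E = insert (w, 0) {(v, Suc 0) | v. (w, v) \<in> acc M \<alpha>}"
  define r where "r = {(e, e') \<in> E \<times> E. (fst e, fst e') \<in> acc M \<alpha>}"
  have EW: "fst e \<in> worlds M" if "e \<in> E" for e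
    using that w by (auto simp: E_def dest: acc_worlds)
  have succ: "((v, i), (v', Suc 0)) \<in> r" if "(v, i) \<in> E" "(v, v') \<in> acc M \<alpha>" for v i v'
    using that L2_trans[OF four, of w v v'] by (auto simp: E_def r_def)
  have "satisfies_cond E r c" if "c \<in> L1 \<alpha>" for c
  proof (cases c)
    case Cond_D
    have "\<exists>e'\<in>E. (e, e') \<in> r" if "e \<in> E" for e
      using L2_serial[of \<alpha> "fst e"] EW[OF that] succ[of "fst e" "snd e"] that \<open>c \<in> L1 \<alpha>\<close> Cond_D eq
      by (fastforce simp: r_def)
    then show ?thesis using Cond_D by simp
  next
    case Cond_T
    then show ?thesis using that eq L2_refl EW by (auto simp: r_def refl_on_def)
  next
    case Cond_B
    then show ?thesis using that eq L2_sym by (auto simp: r_def sym_def)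
  next
    case Cond_4
    show ?thesis unfolding Cond_4 satisfies_cond.simps
      by (rule transI) (use L2_trans[OF four] in \<open>auto simp: r_def\<close>)
  next
    case Cond_5
    then have "precedes Cond_5 x" using that eq prec by auto
    then show ?thesis by (cases x) (auto simp: precedes_def)
  qed
  moreover have "holds M v' \<chi> \<and> md \<chi> + i' \<le> m"
    if "((v, i), (v', i')) \<in> r" "md \<chi> + i < m" "holds M v (Box \<alpha> \<chi>)" for v i v' i' \<chi>
    using that by (auto simp: r_def E_def)
  moreover have "\<exists>v' i'. ((v, i), (v', i')) \<in> r \<and> holds M v' \<chi> \<and> md \<chi> + i' \<le> m"
    if v: "(v, i) \<in> E" "md \<chi> + i < m" "holds M v (Dia \<alpha> \<chi>)" for v i \<chi>
  proof -
    obtain v' where "(v, v') \<in> acc M \<alpha>" "holds M v' \<chi>"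
      using v(3) by auto
    then show ?thesis
      using v succ by (intro exI[of _ v'] exI[of _ "Suc 0"]) auto
  qed
  moreover have "good (m - i) v" if "(v, i) \<in> E" "i < m" for v i
    using good good_succ[OF good] m that by (auto simp: E_def)
  moreover have "r \<subseteq> E \<times> E"
    by (auto simp: r_def)
  moreover have "(w, 0) \<in> E" "\<forall>v. (v, 0) \<in> E \<longrightarrow> v = w" "fst ` E \<subseteq> worlds M"
    using w by (auto simp: E_def dest: acc_worlds)
  ultimately have "component \<alpha> w m E r"
    unfolding component_def by blast
  then show ?thesis by blast
qed

section \<open>Components for added transitivity and added euclideanness\<close>

lemma ax4:
  assumes "x = Cond_4" "\<alpha> \<in> A" "ax_sat u" "\<psi> \<in> sub_bar \<phi>" "holds M u (Box \<alpha> \<psi>)" "(u, v) \<in> acc M \<alpha>"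
  shows "holds M v (Box \<alpha> \<psi>)"
  using assms unfolding ax_sat_def by (fastforce simp: Imp_def)

lemma ax5:
  assumes "x = Cond_5" "\<alpha> \<in> A" "ax_sat u" "\<psi> \<in> sub_bar \<phi>" "(u, v) \<in> acc M \<alpha>" "holds M v (Box \<alpha> \<psi>)"
  shows "holds M u (Box \<alpha> \<psi>)"
  using assms unfolding ax_sat_def by (fastforce simp: Imp_def)

text \<open>Axiom 5 for \<open>neg \<psi>\<close>, contraposed: what is possible is necessarily
  possible.\<close>

lemma ax5_dual:
  assumes "x = Cond_5" "\<alpha> \<in> A" "ax_sat u" "\<psi> \<in> sub_bar \<phi>" "holds M u (Dia \<alpha> \<psi>)" "(u, v) \<in> acc M \<alpha>"
  shows "holds M v (Dia \<alpha> \<psi>)"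
proof (rule ccontr)
  assume "\<not> ?thesis"
  then have "holds M v (Box \<alpha> (neg \<psi>))"
    by simp
  from ax5[OF assms(1-3) neg_sub_bar[OF assms(4)] assms(6) this] show False
    using assms(5) by auto
qed

text \<open>Edges require only that boxes persist and that their bodies become true, which composes.
  One unit pays for every point of \<open>C\<close>: strict growth of \<open>boxes\<close> takes
  fewer than \<open>fsize \<phi>\<close> steps, and one arbitrary step follows.\<close>

lemma component_four:
  assumes w: "w \<in> worlds M" and good: "good m w" and m: "m \<ge> 1"
    and x: "x = Cond_4" and \<alpha>: "\<alpha> \<in> A" and noB: "Cond_B \<notin> L2 \<alpha>"
  shows "\<exists>E r. component \<alpha> w m E r"
proof -
  define K where "K = {\<zeta> \<in> sub \<phi>. \<exists>\<psi>. \<zeta> = Box \<alpha> \<psi> \<or> \<zeta> = Dia \<alpha> \<psi>}"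
  \<comment> \<open>Dual boxes of diamonds are included so that equality of \<open>boxes\<close> transfers diamonds too.\<close>
  define X where "X = {\<psi>. Box \<alpha> \<psi> \<in> sub \<phi>} \<union> neg ` {\<psi>. Dia \<alpha> \<psi> \<in> sub \<phi>}"
  define boxes where "boxes u = {\<psi> \<in> X. holds M u (Box \<alpha> \<psi>)}" for u
  define S where "S = {(u, v) \<in> acc M \<alpha>. boxes u \<subset> boxes v}"
  define C where "C = {v. \<exists>u. (w, u) \<in> S\<^sup>* \<and> (u, v) \<in> acc M \<alpha>}"
  define E where "E = insert (w, 0) {(v, Suc 0) | v. v \<in> C}"
  define Q where "Q u v \<longleftrightarrow> boxes u \<subseteq> boxes v \<and> (\<forall>\<psi>\<in>boxes u. holds M v \<psi>)" for u v
  define r where "r = {(e, e') \<in> E \<times> E. Q (fst e) (fst e')}"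
  have "K \<subset> sub \<phi>"
    using sub_atomic[of \<phi>] unfolding K_def by blast
  then have K: "card K < fsize \<phi>" "finite K"
    using finite_sub by (auto simp: fsize_def intro: psubset_card_mono finite_subset)
  have "X \<subseteq> (\<lambda>\<zeta>. case \<zeta> of Box _ \<psi> \<Rightarrow> \<psi> | Dia _ \<psi> \<Rightarrow> neg \<psi> | _ \<Rightarrow> TT) ` K"
    by (force simp: X_def K_def image_iff)
  then have X: "card X < fsize \<phi>" "finite X"
    using K by (auto dest: surj_card_le intro: finite_surj)
  have X_bar: "\<psi> \<in> sub_bar \<phi>" if "\<psi> \<in> X" for \<psi>
    using that by (auto simp: X_def intro: sub_bar_modal[OF disjI1] sub_bar_modal[OF disjI2])
  have fin: "finite (boxes u)" for u
    using X by (simp add: boxes_def)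
  have S_pow: "l \<le> card (boxes u) \<and> (w, u) \<in> acc M \<alpha> ^^ l" if "(w, u) \<in> S ^^ l" for u l
    using that
  proof (induction l arbitrary: u)
    case (Suc l)
    then obtain y where y: "(w, y) \<in> S ^^ l" "(y, u) \<in> S"
      by auto
    then have "card (boxes y) < card (boxes u)"
      by (intro psubset_card_mono fin) (auto simp: S_def)
    moreover have "(y, u) \<in> acc M \<alpha>"
      using y(2) by (simp add: S_def)
    ultimately show ?case
      using Suc.IH[OF y(1)] by auto
  qed simp
  have S_dist: "\<exists>l<fsize \<phi>. (w, u) \<in> acc M \<alpha> ^^ l" if u: "(w, u) \<in> S\<^sup>*" for u
  proof -
    obtain l where l: "(w, u) \<in> S ^^ l"
      using rtrancl_imp_relpow[OF u] by blast
    have "card (boxes u) \<le> card X"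
      using X by (auto simp: boxes_def intro: card_mono)
    then show ?thesis
      using S_pow[OF l] X(1) by (intro exI[of _ l]) simp
  qed
  have stride: "stride = fsize \<phi>"
    unfolding stride_def using x by simp
  have far: "fsize \<phi> \<le> m * stride"
    using m by (simp add: stride)
  have acc_Q: "Q u v" if u: "(w, u) \<in> S\<^sup>*" and v: "(u, v) \<in> acc M \<alpha>" for u v
  proof -
    obtain l where l: "l < fsize \<phi>" "(w, u) \<in> acc M \<alpha> ^^ l"
      using S_dist[OF u] by blast
    then have "ax_sat u"
      using far by (intro good_ax[OF good l(2)]) simp
    then have "holds M v (Box \<alpha> \<psi>)" if "\<psi> \<in> boxes u" for \<psi>
      using that X_bar by (intro ax4[OF x \<alpha> _ _ _ v]) (auto simp: boxes_def)
    then show ?thesis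
      using v by (auto simp: Q_def boxes_def)
  qed
  have EW: "fst e \<in> worlds M" if "e \<in> E" for e
    using that w by (auto simp: E_def C_def dest: acc_worlds)
  \<comment> \<open>Where the boxes have stopped growing, edges may leave from the predecessor instead.\<close>
  have twin: "\<exists>u\<in>worlds M. (w, u) \<in> S\<^sup>* \<and> boxes u = boxes v"
    if v: "(v, i) \<in> E" for v i
  proof (cases "v = w")
    case True
    then show ?thesis using w by blast
  next
    case False
    then obtain u where u: "(w, u) \<in> S\<^sup>*" "(u, v) \<in> acc M \<alpha>"
      using v by (auto simp: E_def C_def)
    then have "boxes u \<subseteq> boxes v"
      using acc_Q by (simp add: Q_def)
    then have "boxes u = boxes v \<or> (u, v) \<in> S"
      using u(2) by (auto simp: S_def)
    then show ?thesis
      using u acc_worlds[OF u(2)] by (metis rtrancl_into_rtrancl)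
  qed
  \<comment> \<open>\<open>Q\<close> depends on its source only through \<open>boxes\<close>, so a
    point may borrow the outgoing edges of its twin.\<close>
  have Q_E: "((v, i), (v', Suc 0)) \<in> r" if "(v, i) \<in> E" "(w, u) \<in> S\<^sup>*" "(u, v') \<in> acc M \<alpha>" "boxes u = boxes v"
    for v i v' u
    using that acc_Q[of u v'] by (auto simp: r_def E_def C_def Q_def)
  have "satisfies_cond E r c" if "c \<in> L1 \<alpha>" for c
  proof (cases c)
    case Cond_D
    then have D: "Cond_D \<in> L2 \<alpha>"
      using that L1_in[OF \<alpha>] x by auto
    have "\<exists>e'\<in>E. (e, e') \<in> r" if e: "e \<in> E" for e
    proof -
      obtain v i where vi: "e = (v, i)"
        by (cases e)
      obtain u where u: "u \<in> worlds M" "(w, u) \<in> S\<^sup>*" "boxes u = boxes v"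
        using twin e vi by blast
      obtain z where "(u, z) \<in> acc M \<alpha>"
        using L2_serial[OF D u(1)] by blast
      then have "(e, (z, Suc 0)) \<in> r"
        using Q_E e u vi by blast
      then show ?thesis
        unfolding r_def by blast
    qed
    then show ?thesis using Cond_D by simp
  next
    case Cond_T
    then have "Cond_T \<in> L2 \<alpha>"
      using that L1_in[OF \<alpha>] x by auto
    then have "(u, u) \<in> acc M \<alpha>" if "u \<in> worlds M" for u
      using that by (rule L2_refl)
    then have "Q u u" if "u \<in> worlds M" for u
      using that by (simp add: Q_def boxes_def)
    then show ?thesis using Cond_T EW by (simp add: refl_on_def r_def)
  next
    case Cond_B
    then show ?thesis using that noB L1_in[OF \<alpha>] x by auto
  next
    case Cond_4
    have "Q u z" if "Q u v" "Q v z" for u v z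
      using that by (auto simp: Q_def)
    then show ?thesis unfolding Cond_4 satisfies_cond.simps
      by (intro transI) (auto simp: r_def)
  next
    case Cond_5
    then show ?thesis using that L1_in[OF \<alpha>] x prec by (fastforce simp: precedes_def)
  qed
  moreover have "holds M v' \<chi> \<and> md \<chi> + i' \<le> m"
    if "((v, i), (v', i')) \<in> r" "Box \<alpha> \<chi> \<in> sub \<phi>" "md \<chi> + i < m" "holds M v (Box \<alpha> \<chi>)"
    for v i v' i' \<chi>
    using that by (auto simp: r_def E_def Q_def boxes_def X_def)
  moreover have "\<exists>v' i'. ((v, i), (v', i')) \<in> r \<and> holds M v' \<chi> \<and> md \<chi> + i' \<le> m"
    if v: "(v, i) \<in> E" and \<chi>: "Dia \<alpha> \<chi> \<in> sub \<phi>" "md \<chi> + i < m" "holds M v (Dia \<alpha> \<chi>)" for v i \<chi>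
  proof -
    have "neg \<chi> \<notin> boxes v" "neg \<chi> \<in> X"
      using \<chi> by (auto simp: boxes_def X_def)
    obtain u where u: "(w, u) \<in> S\<^sup>*" "boxes u = boxes v"
      using twin[OF v] by blast
    have "neg \<chi> \<notin> boxes u"
      using u(2) \<open>neg \<chi> \<notin> boxes v\<close> by blast
    then obtain v' where "(u, v') \<in> acc M \<alpha>" "holds M v' \<chi>"
      using \<open>neg \<chi> \<in> X\<close> by (auto simp: boxes_def)
    then show ?thesis
      using Q_E[OF v u(1) _ u(2)] \<chi>(2) by (intro exI[of _ v'] exI[of _ "Suc 0"]) auto
  qed
  moreover have "good (m - i) v" if v: "(v, i) \<in> E" and i: "i < m" for v i
  proof (cases "i = 0")
    case True
    then show ?thesis using v good by (auto simp: E_def)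
  next
    case False
    then obtain u where u: "(w, u) \<in> S\<^sup>*" "(u, v) \<in> acc M \<alpha>" and i1: "i = Suc 0"
      using v by (auto simp: E_def C_def)
    obtain l where l: "l < fsize \<phi>" "(w, u) \<in> acc M \<alpha> ^^ l"
      using S_dist[OF u(1)] by blast
    have "(w, v) \<in> acc M \<alpha> ^^ Suc l"
      using l u by auto
    \<comment> \<open>The unit lost between \<open>m\<close> and \<open>m - Suc 0\<close> pays for
      \<open>fsize \<phi>\<close> steps, hence for \<open>Suc l\<close>.\<close>
    moreover have "Suc l + (m - Suc 0) * stride \<le> m * stride"
      using l m stride by (cases m) auto
    ultimately show ?thesis
      unfolding i1 by (rule good_far[OF good])
  qed
  moreover have "r \<subseteq> E \<times> E"
    by (auto simp: r_def)
  moreover have "(w, 0) \<in> E" "\<forall>v. (v, 0) \<in> E \<longrightarrow> v = w" "fst ` E \<subseteq> worlds M"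
    using w by (auto simp: E_def C_def dest: acc_worlds)
  ultimately have "component \<alpha> w m E r"
    unfolding component_def by blast
  then show ?thesis by blast
qed

text \<open>Without reflexivity, symmetry or transitivity, a diamond true at distance one may only have
  witnesses at distance two from the root; those already suffice for the diamonds at distance two,
  as axiom \<open>5\<close> for \<open>Box \<alpha> (neg \<chi>)\<close> moves them back to distance one.\<close>
lemma component_five:
  assumes w: "w \<in> worlds M" and good: "good m w" and m: "m \<ge> 1"
    and x: "x = Cond_5" and \<alpha>: "\<alpha> \<in> A" and L: "L2 \<alpha> \<subseteq> {Cond_D}"
  shows "\<exists>E r. component \<alpha> w m E r"
proof -
  define C1 where "C1 = {(v, Suc 0) | v. (w, v) \<in> acc M \<alpha>}"
  define C2 where "C2 = {(z, Suc (Suc 0)) | z. \<exists>v. (w, v) \<in> acc M \<alpha> \<and> (v, z) \<in> acc M \<alpha>}"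
  define E where "E = insert (w, 0) (C1 \<union> C2)"
  \<comment> \<open>The root sees only distance one, and the cluster is universal. No edge enters
    \<open>(w, 0)\<close>, so the relation is euclidean even if the world \<open>w\<close> recurs in
    the cluster with another cost.\<close>
  define r where "r = {(w, 0)} \<times> C1 \<union> (C1 \<union> C2) \<times> (C1 \<union> C2)"
  have ax0: "ax_sat w"
    using ax_sat_self[OF good] .
  have ax1: "ax_sat v" if "(w, v) \<in> acc M \<alpha>" for v
    using ax_sat_succ[OF good that m] .
  have path2: "(w, z) \<in> acc M \<alpha> ^^ 2" if "(w, v) \<in> acc M \<alpha>" "(v, z) \<in> acc M \<alpha>" for v z
    using that by (auto simp: numeral_2_eq_2)
  \<comment> \<open>The box at \<open>v\<close> makes a box possible at the root; the dual form of
    axiom 5 passes this to \<open>u\<close>, where axiom 5 itself turns the possible box into a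
    box.\<close>
  have spread: "holds M u (Box \<alpha> \<psi>)"
    if v: "(w, v) \<in> acc M \<alpha>" "holds M v (Box \<alpha> \<psi>)" and u: "(w, u) \<in> acc M \<alpha>"
      and \<psi>: "\<psi> \<in> sub_bar \<phi>" "Box \<alpha> \<psi> \<in> sub_bar \<phi>" for u v \<psi>
  proof -
    have "holds M w (Dia \<alpha> (Box \<alpha> \<psi>))"
      using v by auto
    then have "holds M u (Dia \<alpha> (Box \<alpha> \<psi>))"
      by (rule ax5_dual[OF x \<alpha> ax0 \<psi>(2) _ u])
    then show ?thesis
      using ax5[OF x \<alpha> ax1[OF u] \<psi>(1)] by auto
  qed
  have "satisfies_cond E r c" if "c \<in> L1 \<alpha>" for c
  proof -
    have "c = Cond_D \<and> Cond_D \<in> L2 \<alpha> \<or> c = Cond_5"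
      using that L L1_in[OF \<alpha>] x by auto
    then show ?thesis
    proof (elim disjE conjE)
      assume D: "c = Cond_D" "Cond_D \<in> L2 \<alpha>"
      obtain v where "(w, v) \<in> acc M \<alpha>"
        using L2_serial[OF D(2) w] by blast
      then have "(v, Suc 0) \<in> C1"
        by (simp add: C1_def)
      then show ?thesis
        using D(1) by (auto simp: E_def r_def)
    next
      assume "c = Cond_5"
      moreover have "(w, 0) \<notin> C1 \<union> C2"
        by (auto simp: C1_def C2_def)
      ultimately show ?thesis
        by (simp only: satisfies_cond.simps r_def) blast
    qed
  qed
  moreover have "holds M v' \<chi> \<and> md \<chi> + i' \<le> m"
    if e: "((v, i), (v', i')) \<in> r" and \<chi>: "Box \<alpha> \<chi> \<in> sub \<phi>" "md \<chi> + i < m" "holds M v (Box \<alpha> \<chi>)"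
    for v i v' i' \<chi>
  proof -
    have bar: "\<chi> \<in> sub_bar \<phi>" "Box \<alpha> \<chi> \<in> sub_bar \<phi>"
      using \<chi>(1) by (auto intro: sub_bar_modal(1) sub_bar_Box)
    show ?thesis
    proof (cases "(v, i) = (w, 0)")
      case True
      then have "(w, v') \<in> acc M \<alpha>" "i' = Suc 0"
        using e by (auto simp: r_def C1_def C2_def)
      then show ?thesis
        using True \<chi> by auto
    next
      case False
      then have e': "(v, i) \<in> C1 \<union> C2" "(v', i') \<in> C1 \<union> C2"
        using e by (auto simp: r_def)
      \<comment> \<open>With \<open>i \<ge> 1\<close> the bound \<open>md \<chi> + i < m\<close>
        gives \<open>md \<chi> + 2 \<le> m\<close>, so a target of cost two is affordable.\<close>
      then have i: "i \<ge> 1" "i' \<le> 2"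
        by (auto simp: C1_def C2_def)
      obtain u where u: "(w, u) \<in> acc M \<alpha>" "holds M u (Box \<alpha> \<chi>)"
      proof (cases "(v, i) \<in> C1")
        case True
        then show ?thesis using \<chi>(3) by (intro that[of v]) (auto simp: C1_def)
      next
        case False
        then obtain u where "(w, u) \<in> acc M \<alpha>" "(u, v) \<in> acc M \<alpha>"
          using e' by (auto simp: C2_def)
        then show ?thesis
          using that ax5[OF x \<alpha> ax1 bar(1)] \<chi>(3) by blast
      qed
      have "holds M w (Box \<alpha> \<chi>)"
        by (rule ax5[OF x \<alpha> ax0 bar(1) u])
      then have "holds M v' \<chi>"
        using e'(2) spread[OF u _ bar] by (auto simp: C1_def C2_def)
      then show ?thesis
        using \<chi>(2) i by simp
    qed
  qed
  moreover have "\<exists>v' i'. ((v, i), (v', i')) \<in> r \<and> holds M v' \<chi> \<and> md \<chi> + i' \<le> m"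
    if v: "(v, i) \<in> E" and \<chi>: "Dia \<alpha> \<chi> \<in> sub \<phi>" "md \<chi> + i < m" "holds M v (Dia \<alpha> \<chi>)" for v i \<chi>
  proof -
    have bar: "neg \<chi> \<in> sub_bar \<phi>" "Box \<alpha> (neg \<chi>) \<in> sub_bar \<phi>"
      using \<chi>(1) by (auto intro: sub_bar_modal(2) sub_bar_Box)
    consider "(v, i) = (w, 0)" | "(v, i) \<in> C1" | "(v, i) \<in> C2"
      using v by (auto simp: E_def)
    then show ?thesis
    proof cases
      case 1
      obtain v' where v': "(v, v') \<in> acc M \<alpha>" "holds M v' \<chi>"
        using \<chi>(3) by auto
      then have "((v, i), (v', Suc 0)) \<in> r"
        using 1 by (simp add: r_def C1_def)
      then show ?thesis
        using v' 1 \<chi>(2) by (intro exI[of _ v'] exI[of _ "Suc 0"]) simp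
    next
      case 2
      obtain v' where v': "(v, v') \<in> acc M \<alpha>" "holds M v' \<chi>"
        using \<chi>(3) by auto
      then have "((v, i), (v', Suc (Suc 0))) \<in> r"
        using 2 by (auto simp: r_def C1_def C2_def)
      then show ?thesis
        using v' 2 \<chi>(2) by (intro exI[of _ v'] exI[of _ "Suc (Suc 0)"]) (simp add: C1_def)
    next
      case 3
      then obtain u where u: "(w, u) \<in> acc M \<alpha>" "(u, v) \<in> acc M \<alpha>" and i: "i = Suc (Suc 0)"
        by (auto simp: C2_def)
      have "ax_sat v"
        using good_ax_le[OF good path2[OF u]] \<chi>(2) i by simp
      have "holds M u (Dia \<alpha> \<chi>)"
      proof (rule ccontr)
        assume "\<not> ?thesis"
        then have "holds M u (Box \<alpha> (neg \<chi>))"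
          by simp
        then have "holds M w (Dia \<alpha> (Box \<alpha> (neg \<chi>)))"
          using u(1) by auto
        then have "holds M u (Dia \<alpha> (Box \<alpha> (neg \<chi>)))"
          by (rule ax5_dual[OF x \<alpha> ax0 bar(2) _ u(1)])
        then have "holds M v (Dia \<alpha> (Box \<alpha> (neg \<chi>)))"
          by (rule ax5_dual[OF x \<alpha> ax1[OF u(1)] bar(2) _ u(2)])
        then have "holds M v (Box \<alpha> (neg \<chi>))"
          using ax5[OF x \<alpha> \<open>ax_sat v\<close> bar(1)] by auto
        then show False
          using \<chi>(3) by auto
      qed
      then obtain v' where v': "(u, v') \<in> acc M \<alpha>" "holds M v' \<chi>"
        by auto
      then have "((v, i), (v', Suc (Suc 0))) \<in> r"
        using 3 u by (auto simp: r_def C2_def)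
      then show ?thesis
        using v' \<chi>(2) i by (intro exI[of _ v'] exI[of _ "Suc (Suc 0)"]) simp
    qed
  qed
  moreover have "good (m - i) v" if v: "(v, i) \<in> E" and i: "i < m" for v i
  proof -
    have "(w, v) \<in> acc M \<alpha> ^^ i"
      using v by (auto simp: E_def C1_def C2_def)
    then show ?thesis
      using good_near[OF good] i by simp
  qed
  moreover have "r \<subseteq> E \<times> E"
    by (auto simp: r_def E_def)
  moreover have "(w, 0) \<in> E" "\<forall>v. (v, 0) \<in> E \<longrightarrow> v = w" "fst ` E \<subseteq> worlds M"
    using w by (auto simp: E_def C1_def C2_def dest: acc_worlds)
  ultimately have "component \<alpha> w m E r"
    unfolding component_def by blast
  then show ?thesis by blast
qed

text \<open>With symmetric edges axiom 4 also acts against an edge, so the root and its successors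
  agree on boxes. A root with a successor may see itself, since a box is passed to the successor and
  its body comes back.\<close>

lemma component_cluster_four:
  assumes w: "w \<in> worlds M" and good: "good m w" and m: "m \<ge> 1"
    and x: "x = Cond_4" and \<alpha>: "\<alpha> \<in> A" and B: "Cond_B \<in> L2 \<alpha>"
  shows "\<exists>E r. component \<alpha> w m E r"
proof (rule component_cluster[OF w good m, where loop = "\<exists>v. (w, v) \<in> acc M \<alpha>"])
  fix v \<psi> assume v: "(w, v) \<in> acc M \<alpha>"
  show "holds M w (Box \<alpha> \<psi>)" if "Box \<alpha> \<psi> \<in> sub \<phi>" "holds M v (Box \<alpha> \<psi>)"
  proof -
    have "\<psi> \<in> sub_bar \<phi>"
      using that(1) by (intro sub_bar_modal(1)) blast
    from ax4[OF x \<alpha> ax_sat_succ[OF good v m] this that(2) L2_sym[OF B v]] show ?thesis .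
  qed
  show "holds M w (Dia \<alpha> \<psi>)" if "Dia \<alpha> \<psi> \<in> sub \<phi>" "holds M v (Dia \<alpha> \<psi>)"
  proof (rule ccontr)
    assume "\<not> ?thesis"
    then have "holds M w (Box \<alpha> (neg \<psi>))"
      by simp
    moreover have "neg \<psi> \<in> sub_bar \<phi>"
      using that(1) by (intro sub_bar_modal(2)) blast
    ultimately have "holds M v (Box \<alpha> (neg \<psi>))"
      using ax4[OF x \<alpha> ax_sat_self[OF good]] v by blast
    then show False
      using that(2) by auto
  qed
next
  fix \<psi> assume "\<exists>v. (w, v) \<in> acc M \<alpha>" "Box \<alpha> \<psi> \<in> sub \<phi>" "holds M w (Box \<alpha> \<psi>)"
  then obtain v where v: "(w, v) \<in> acc M \<alpha>"
    by blast
  have "\<psi> \<in> sub_bar \<phi>"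
    using \<open>Box \<alpha> \<psi> \<in> sub \<phi>\<close> by (intro sub_bar_modal(1)) blast
  then have "holds M v (Box \<alpha> \<psi>)"
    using ax4[OF x \<alpha> ax_sat_self[OF good]] v \<open>holds M w (Box \<alpha> \<psi>)\<close> by blast
  then show "holds M w \<psi>"
    using L2_sym[OF B v] by simp
next
  show "(\<exists>v. (w, v) \<in> acc M \<alpha>) \<or> (\<exists>v. (w, v) \<in> acc M \<alpha>)" if "Cond_D \<in> L1 \<alpha>"
    using that L2_serial w L1_in[OF \<alpha>] x by auto
  show "\<exists>v. (w, v) \<in> acc M \<alpha>" if "Cond_T \<in> L1 \<alpha>"
    using that L2_refl[of \<alpha> w] w L1_in[OF \<alpha>] x by auto
qed blast

text \<open>Axiom 5 pulls boxes back to the root. For diamonds transitivity suffices; otherwise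
  suppose \<open>Box \<alpha> (neg \<psi>)\<close> at the root. By symmetry, or by reflexivity and
  the dual axiom, this box is possible at the successor, where axiom 5 makes it true and contradicts
  the diamond.\<close>

lemma component_cluster_five:
  assumes w: "w \<in> worlds M" and good: "good m w" and m: "m \<ge> 1"
    and x: "x = Cond_5" and \<alpha>: "\<alpha> \<in> A"
    and L: "Cond_T \<in> L2 \<alpha> \<or> Cond_B \<in> L2 \<alpha> \<or> Cond_4 \<in> L2 \<alpha>"
  shows "\<exists>E r. component \<alpha> w m E r"
proof (rule component_cluster[OF w good m,
      where loop = "Cond_T \<in> L2 \<alpha> \<or> Cond_B \<in> L2 \<alpha> \<and> (\<exists>v. (w, v) \<in> acc M \<alpha>)"])
  fix v \<psi> assume v: "(w, v) \<in> acc M \<alpha>"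
  show "holds M w (Box \<alpha> \<psi>)" if "Box \<alpha> \<psi> \<in> sub \<phi>" "holds M v (Box \<alpha> \<psi>)"
  proof -
    have "\<psi> \<in> sub_bar \<phi>"
      using that(1) by (intro sub_bar_modal(1)) blast
    from ax5[OF x \<alpha> ax_sat_self[OF good] this v that(2)] show ?thesis .
  qed
  show "holds M w (Dia \<alpha> \<psi>)" if \<psi>: "Dia \<alpha> \<psi> \<in> sub \<phi>" "holds M v (Dia \<alpha> \<psi>)"
  proof (cases "Cond_4 \<in> L2 \<alpha>")
    case True
    then show ?thesis
      using \<psi>(2) L2_trans[OF True v] by auto
  next
    case False
    show ?thesis
    proof (rule ccontr)
      assume "\<not> ?thesis"
      then have box: "holds M w (Box \<alpha> (neg \<psi>))"
        by simp
      have bar: "neg \<psi> \<in> sub_bar \<phi>" "Box \<alpha> (neg \<psi>) \<in> sub_bar \<phi>"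
        using \<psi>(1) by (auto intro: sub_bar_modal(2) sub_bar_Box)
      have "holds M v (Dia \<alpha> (Box \<alpha> (neg \<psi>)))"
      proof (cases "Cond_B \<in> L2 \<alpha>")
        case True
        then show ?thesis
          using L2_sym[OF True v] box by auto
      next
        case False
        then have "(w, w) \<in> acc M \<alpha>"
          using L \<open>Cond_4 \<notin> L2 \<alpha>\<close> L2_refl w by blast
        then have "holds M w (Dia \<alpha> (Box \<alpha> (neg \<psi>)))"
          using box by auto
        then show ?thesis
          by (rule ax5_dual[OF x \<alpha> ax_sat_self[OF good] bar(2) _ v])
      qed
      then have "holds M v (Box \<alpha> (neg \<psi>))"
        using ax5[OF x \<alpha> ax_sat_succ[OF good v m] bar(1)] by auto
      then show False
        using \<psi>(2) by auto
    qed
  qed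
next
  fix \<psi> assume loop: "Cond_T \<in> L2 \<alpha> \<or> Cond_B \<in> L2 \<alpha> \<and> (\<exists>v. (w, v) \<in> acc M \<alpha>)"
    and \<psi>: "Box \<alpha> \<psi> \<in> sub \<phi>" "holds M w (Box \<alpha> \<psi>)"
  show "holds M w \<psi>"
  proof (cases "Cond_T \<in> L2 \<alpha>")
    case True
    then show ?thesis
      using L2_refl[OF True w] \<psi>(2) by simp
  next
    case False
    then obtain v where v: "(w, v) \<in> acc M \<alpha>" "(v, w) \<in> acc M \<alpha>"
      using loop L2_sym by blast
    have "\<psi> \<in> sub_bar \<phi>"
      using \<psi>(1) by (intro sub_bar_modal(1)) blast
    then have "holds M v (Box \<alpha> \<psi>)"
      using ax5[OF x \<alpha> ax_sat_succ[OF good v(1) m] _ v(2) \<psi>(2)] by blast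
    then show ?thesis
      using v(2) by simp
  qed
next
  have L1: "L1 \<alpha> = insert Cond_5 (L2 \<alpha>)"
    using L1_in[OF \<alpha>] x by simp
  show "(Cond_T \<in> L2 \<alpha> \<or> Cond_B \<in> L2 \<alpha> \<and> (\<exists>v. (w, v) \<in> acc M \<alpha>)) \<or> (\<exists>v. (w, v) \<in> acc M \<alpha>)"
    if "Cond_D \<in> L1 \<alpha>"
    using that L2_serial w L1 by blast
  show "Cond_T \<in> L2 \<alpha> \<or> Cond_B \<in> L2 \<alpha> \<and> (\<exists>v. (w, v) \<in> acc M \<alpha>)" if "Cond_T \<in> L1 \<alpha>"
    using that L1 by blast
  show "(Cond_T \<in> L2 \<alpha> \<or> Cond_B \<in> L2 \<alpha> \<and> (\<exists>v. (w, v) \<in> acc M \<alpha>)) \<or> (\<forall>v. (w, v) \<notin> acc M \<alpha>)"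
    if "Cond_B \<in> L1 \<alpha>"
    using that L1 by blast
qed

text \<open>The order of the conditions makes the cases exhaustive: \<open>L2\<close> never contains
  5, and it contains 4 only if \<open>x\<close> is 5.\<close>

lemma component_exists:
  assumes w: "w \<in> worlds M" and good: "m > 0 \<Longrightarrow> good m w"
  shows "\<exists>E r. component \<alpha> w m E r"
proof (cases "m = 0")
  case True
  then show ?thesis
    using component_trivial[OF w] by blast
next
  case False
  then have g: "good m w" and m: "m \<ge> 1"
    using good by auto
  have no5: "Cond_5 \<notin> L2 \<alpha>"
    using prec[of Cond_5 \<alpha>] by (cases x) (auto simp: precedes_def)
  have no4: "Cond_4 \<notin> L2 \<alpha>" if "x \<noteq> Cond_5"
    using prec[of Cond_4 \<alpha>] that by (cases x) (auto simp: precedes_def)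
  have sub: "K \<subseteq> {Cond_D, Cond_T, Cond_B}" if "Cond_4 \<notin> K" "Cond_5 \<notin> K" for K
  proof
    fix c assume "c \<in> K"
    then show "c \<in> {Cond_D, Cond_T, Cond_B}"
      using that by (cases c) auto
  qed
  consider (layered) "L1 \<alpha> \<subseteq> {Cond_D, Cond_T, Cond_B}"
    | (old) "\<alpha> \<notin> A" "Cond_4 \<in> L2 \<alpha>"
    | (four) "\<alpha> \<in> A" "x = Cond_4"
    | (five) "\<alpha> \<in> A" "x = Cond_5"
    using sub[of "L1 \<alpha>"] L1_in[of \<alpha>] L1_notin[of \<alpha>] no4 no5 by (cases "\<alpha> \<in> A") auto
  then show ?thesis
  proof cases
    case layered
    then show ?thesis by (rule component_layered[OF w g])
  next
    case old
    then show ?thesis using component_transitive[OF w g m] L1_notin by blast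
  next
    case four
    then show ?thesis using component_cluster_four[OF w g m] component_four[OF w g m] by blast
  next
    case five
    have "L2 \<alpha> \<subseteq> {Cond_D} \<or> Cond_T \<in> L2 \<alpha> \<or> Cond_B \<in> L2 \<alpha> \<or> Cond_4 \<in> L2 \<alpha>"
      using sub[of "L2 \<alpha>"] no5 by auto
    then show ?thesis
      using component_five[OF w g m] component_cluster_five[OF w g m] five by blast
  qed
qed

lemma tau_good:
  assumes "holds M s (tau p A x \<phi>)"
  shows "holds M s \<phi>" "good (md \<phi>) s"
proof -
  have fin: "finite (sub_bar \<phi> \<times> A)"
    by (intro finite_cartesian_product finite_sub_bar finite)
  have depth: "tau_depth x \<phi> = md \<phi> * stride"
    by (simp add: tau_depth_def stride_def)
  show "holds M s \<phi>" "good (md \<phi>) s"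
    using assms unfolding tau_def good_def ax_sat_def depth
    by (simp_all add: holds_Inv holds_Conj[OF fin])
qed

end

section \<open>The tree of components\<close>

text \<open>A node lists the points visited from the root of the tree, most recent first; points that are
  roots of components are never listed.\<close>
type_synonym ('w, 'a) node = "('a \<times> 'w \<times> nat) list"

locale unravelling = reduction M A x L1 L2 \<phi> p
  for M :: "('w, 'a::finite, 'p) kripke" and A x L1 L2 \<phi> p +
  fixes s :: 'w
    and E :: "'a \<Rightarrow> 'w \<Rightarrow> nat \<Rightarrow> ('w \<times> nat) set"
    and r :: "'a \<Rightarrow> 'w \<Rightarrow> nat \<Rightarrow> ('w \<times> nat) rel"
  assumes s: "s \<in> worlds M" and good_s: "good (md \<phi>) s"
    and comp: "w \<in> worlds M \<Longrightarrow> (m > 0 \<Longrightarrow> good m w) \<Longrightarrow> component \<alpha> w m (E \<alpha> w m) (r \<alpha> w m)"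
begin

fun world :: "('w, 'a) node \<Rightarrow> 'w" where
  "world [] = s"
| "world ((\<alpha>, v, i) # y) = v"

fun rank :: "('w, 'a) node \<Rightarrow> nat" where
  "rank [] = md \<phi>"
| "rank ((\<alpha>, v, i) # y) = rank y - i"

text \<open>Each valid node lies in one component of every agent; \<open>owner\<close> is the root
  of that component, and \<open>elem\<close> below is the point that the node occupies in
  it.\<close>

fun owner :: "'a \<Rightarrow> ('w, 'a) node \<Rightarrow> ('w, 'a) node" where
  "owner \<alpha> [] = []"
| "owner \<alpha> ((\<beta>, v, i) # y) = (if \<alpha> = \<beta> then y else (\<beta>, v, i) # y)"

fun elem :: "'a \<Rightarrow> ('w, 'a) node \<Rightarrow> 'w \<times> nat" where
  "elem \<alpha> [] = (s, 0)"
| "elem \<alpha> ((\<beta>, v, i) # y) = (v, if \<alpha> = \<beta> then i else 0)"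

text \<open>The condition \<open>owner \<alpha> y = y\<close> forbids opening an \<alpha>-component
  at a node that was itself reached along \<alpha>, which would put that node into two of
  them.\<close>

fun valid :: "('w, 'a) node \<Rightarrow> bool" where
  "valid [] \<longleftrightarrow> True"
| "valid ((\<alpha>, v, i) # y) \<longleftrightarrow>
     valid y \<and> (v, i) \<in> E \<alpha> (world y) (rank y) \<and> i \<noteq> 0 \<and> owner \<alpha> y = y"

abbreviation carrier :: "'a \<Rightarrow> ('w, 'a) node \<Rightarrow> ('w \<times> nat) set" where
  "carrier \<alpha> y \<equiv> E \<alpha> (world y) (rank y)"

abbreviation edges :: "'a \<Rightarrow> ('w, 'a) node \<Rightarrow> ('w \<times> nat) rel" where
  "edges \<alpha> y \<equiv> r \<alpha> (world y) (rank y)"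

text \<open>The \<alpha>-relation is the disjoint union of the \<alpha>-components, told apart by
  their owners.\<close>

definition tree :: "(('w, 'a) node, 'a, 'p) kripke" where
  "tree = \<lparr>worlds = Collect valid,
     rel = {(y, \<alpha>, z). valid y \<and> valid z \<and> owner \<alpha> y = owner \<alpha> z \<and>
              (elem \<alpha> y, elem \<alpha> z) \<in> edges \<alpha> (owner \<alpha> y)},
     val = val M \<circ> world\<rparr>"

section \<open>Frame conditions and truth in the tree\<close>

lemma worlds_tree: "worlds tree = Collect valid"
  by (simp add: tree_def)

lemma acc_tree:
  "(y, z) \<in> acc tree \<alpha> \<longleftrightarrow> valid y \<and> valid z \<and> owner \<alpha> y = owner \<alpha> z \<and>
     (elem \<alpha> y, elem \<alpha> z) \<in> edges \<alpha> (owner \<alpha> y)"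
  by (simp add: acc_def tree_def)

lemma valid_good: "valid y \<Longrightarrow> world y \<in> worlds M \<and> (rank y > 0 \<longrightarrow> good (rank y) (world y))"
proof (induction y rule: valid.induct)
  case 1
  then show ?case using s good_s by simp
next
  case (2 \<alpha> v i y)
  then have y: "component \<alpha> (world y) (rank y) (carrier \<alpha> y) (edges \<alpha> y)"
    by (intro comp) auto
  have vi: "(v, i) \<in> carrier \<alpha> y"
    using 2(2) by simp
  have "fst ` carrier \<alpha> y \<subseteq> worlds M"
    using y by (simp add: component_def)
  then have "v \<in> worlds M"
    using vi by auto
  moreover have "i < rank y \<longrightarrow> good (rank y - i) v"
    using y vi unfolding component_def by blast
  ultimately show ?case
    by simp
qed

lemma valid_comp: "valid y \<Longrightarrow> component \<alpha> (world y) (rank y) (carrier \<alpha> y) (edges \<alpha> y)"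
  using valid_good by (intro comp) auto

lemma valid_owner:
  assumes "valid y"
  shows "valid (owner \<alpha> y)" "owner \<alpha> (owner \<alpha> y) = owner \<alpha> y"
    "elem \<alpha> y \<in> carrier \<alpha> (owner \<alpha> y)"
    "world y = fst (elem \<alpha> y)" "rank y = rank (owner \<alpha> y) - snd (elem \<alpha> y)"
proof -
  have root: "(world y, 0) \<in> carrier \<alpha> y"
    using valid_comp[OF assms] by (simp add: component_def)
  show "valid (owner \<alpha> y)" "owner \<alpha> (owner \<alpha> y) = owner \<alpha> y"
    "elem \<alpha> y \<in> carrier \<alpha> (owner \<alpha> y)"
    "world y = fst (elem \<alpha> y)" "rank y = rank (owner \<alpha> y) - snd (elem \<alpha> y)"
    using assms root by (cases y rule: valid.cases; force)+
qed

text \<open>A point of cost 0 can only be the root of the component and is represented by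
  \<open>y\<close> itself; any other point becomes a new entry.\<close>

lemma node_exists:
  assumes y: "valid y" "owner \<alpha> y = y" and e: "e \<in> carrier \<alpha> y"
  shows "\<exists>z. valid z \<and> owner \<alpha> z = y \<and> elem \<alpha> z = e"
proof -
  obtain v i where vi: "e = (v, i)"
    by (cases e)
  show ?thesis
  proof (cases "i = 0")
    case True
    then have "v = world y"
      using valid_comp[OF y(1)] e vi by (auto simp: component_def)
    moreover have "elem \<alpha> y = (world y, 0)"
      using y(2) by (cases y rule: valid.cases) auto
    ultimately show ?thesis
      using y vi True by blast
  next
    case False
    then show ?thesis
      using y e vi by (intro exI[of _ "(\<alpha>, v, i) # y"]) simp
  qed
qed

text \<open>Edges stay inside one component, so each condition is inherited from there; for D the
  successor must moreover be realised by a node.\<close>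

lemma tree_cond:
  assumes "c \<in> L1 \<alpha>"
  shows "satisfies_cond (worlds tree) (acc tree \<alpha>) c"
proof -
  have c: "satisfies_cond (carrier \<alpha> y) (edges \<alpha> y) c" if "valid y" for y
    using valid_comp[OF that] assms by (simp add: component_def)
  show ?thesis
  proof (cases c)
    case Cond_D
    have "\<exists>z. (y, z) \<in> acc tree \<alpha> \<and> valid z" if y: "valid y" for y
    proof -
      obtain e where e: "e \<in> carrier \<alpha> (owner \<alpha> y)" "(elem \<alpha> y, e) \<in> edges \<alpha> (owner \<alpha> y)"
        using c[OF valid_owner(1)[OF y]] valid_owner(3)[OF y] unfolding Cond_D satisfies_cond.simps by blast
      obtain z where "valid z" "owner \<alpha> z = owner \<alpha> y" "elem \<alpha> z = e"
        using node_exists[OF valid_owner(1,2)[OF y] e(1)] by blast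
      then show ?thesis
        using y e by (auto simp: acc_tree)
    qed
    then show ?thesis
      unfolding Cond_D satisfies_cond.simps worlds_tree by blast
  next
    case Cond_T
    have "(y, y) \<in> acc tree \<alpha>" if y: "valid y" for y
      using c[OF valid_owner(1)[OF y]] valid_owner(3)[OF y] y Cond_T
      by (simp add: acc_tree refl_on_def)
    then show ?thesis
      using Cond_T by (simp add: refl_on_def worlds_tree acc_tree)
  next
    case Cond_B
    have "(z, y) \<in> acc tree \<alpha>" if yz: "(y, z) \<in> acc tree \<alpha>" for y z
    proof -
      have "valid y"
        using yz by (simp add: acc_tree)
      then have "sym (edges \<alpha> (owner \<alpha> y))"
        using c[OF valid_owner(1)] Cond_B by simp
      then show ?thesis
        using yz unfolding acc_tree by (metis symD)
    qed
    then show ?thesis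
      using Cond_B by (auto intro: symI)
  next
    case Cond_4
    have "(y, u) \<in> acc tree \<alpha>" if yz: "(y, z) \<in> acc tree \<alpha>" "(z, u) \<in> acc tree \<alpha>" for y z u
    proof -
      have "valid y"
        using yz by (simp add: acc_tree)
      then have "trans (edges \<alpha> (owner \<alpha> y))"
        using c[OF valid_owner(1)] Cond_4 by simp
      then show ?thesis
        using yz unfolding acc_tree by (metis transD)
    qed
    then show ?thesis
      unfolding Cond_4 satisfies_cond.simps by (rule transI)
  next
    case Cond_5
    have "(z, u) \<in> acc tree \<alpha>" if yz: "(y, z) \<in> acc tree \<alpha>" "(y, u) \<in> acc tree \<alpha>" for y z u
    proof -
      have y: "valid y"
        using yz by (simp add: acc_tree)
      have "\<forall>a b d. (a, b) \<in> edges \<alpha> (owner \<alpha> y) \<longrightarrow> (a, d) \<in> edges \<alpha> (owner \<alpha> y) \<longrightarrow>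
          (b, d) \<in> edges \<alpha> (owner \<alpha> y)"
        using c[OF valid_owner(1)[OF y]] unfolding Cond_5 satisfies_cond.simps .
      then show ?thesis
        using yz unfolding acc_tree by metis
    qed
    then show ?thesis
      unfolding Cond_5 satisfies_cond.simps by blast
  qed
qed

text \<open>A component edge keeps \<open>md \<chi> + i'\<close> at most the rank of the owner,
  hence \<open>md \<chi>\<close> at most the rank of the target, so the induction hypothesis
  applies.\<close>

lemma tree_truth:
  assumes "valid y" "\<psi> \<in> sub \<phi>" "md \<psi> \<le> rank y" "holds M (world y) \<psi>"
  shows "holds tree y \<psi>"
  using assms
proof (induction \<psi> arbitrary: y)
  case (And \<psi> \<chi>)
  have "\<psi> \<in> sub (And \<psi> \<chi>)" "\<chi> \<in> sub (And \<psi> \<chi>)"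
    by (simp_all add: sub_refl)
  then have "\<psi> \<in> sub \<phi>" "\<chi> \<in> sub \<phi>"
    using And.prems(2) sub_trans by blast+
  then show ?case
    using And by simp
next
  case (Or \<psi> \<chi>)
  have "\<psi> \<in> sub (Or \<psi> \<chi>)" "\<chi> \<in> sub (Or \<psi> \<chi>)"
    by (simp_all add: sub_refl)
  then have "\<psi> \<in> sub \<phi>" "\<chi> \<in> sub \<phi>"
    using Or.prems(2) sub_trans by blast+
  then show ?case
    using Or by auto
next
  case (Dia \<alpha> \<chi>)
  note y = valid_owner[OF Dia.prems(1), of \<alpha>]
  let ?z = "owner \<alpha> y"
  obtain v i where vi: "elem \<alpha> y = (v, i)"
    by (cases "elem \<alpha> y")
  have "(v, i) \<in> carrier \<alpha> ?z" "md \<chi> + i < rank ?z" "holds M v (Dia \<alpha> \<chi>)"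
    using y Dia.prems vi by auto
  then obtain v' i' where e: "((v, i), (v', i')) \<in> edges \<alpha> ?z" "holds M v' \<chi>" "md \<chi> + i' \<le> rank ?z"
    using valid_comp[OF y(1), of \<alpha>] Dia.prems(2) unfolding component_def by blast
  then have "(v', i') \<in> carrier \<alpha> ?z"
    using valid_comp[OF y(1), of \<alpha>] unfolding component_def by blast
  then obtain u where u: "valid u" "owner \<alpha> u = ?z" "elem \<alpha> u = (v', i')"
    using node_exists[OF y(1,2)] by blast
  have "holds tree u \<chi>"
    using valid_owner(4,5)[OF u(1), of \<alpha>] u e Dia.prems(2) by (intro Dia.IH) (auto intro: sub_modal)
  moreover have "(y, u) \<in> acc tree \<alpha>"
    using u e(1) vi Dia.prems(1) by (simp add: acc_tree)
  ultimately show ?case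
    by auto
next
  case (Box \<alpha> \<chi>)
  note y = valid_owner[OF Box.prems(1), of \<alpha>]
  let ?z = "owner \<alpha> y"
  obtain v i where vi: "elem \<alpha> y = (v, i)"
    by (cases "elem \<alpha> y")
  have v: "md \<chi> + i < rank ?z" "holds M v (Box \<alpha> \<chi>)"
    using y Box.prems vi by auto
  have "holds tree u \<chi>" if u: "(y, u) \<in> acc tree \<alpha>" for u
  proof -
    obtain v' i' where vi': "elem \<alpha> u = (v', i')"
      by (cases "elem \<alpha> u")
    have e: "valid u" "owner \<alpha> u = ?z" "((v, i), (v', i')) \<in> edges \<alpha> ?z"
      using u[unfolded acc_tree] vi vi' by auto
    then have "holds M v' \<chi> \<and> md \<chi> + i' \<le> rank ?z"
      using valid_comp[OF y(1), of \<alpha>] v Box.prems(2) unfolding component_def by blast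
    then show ?thesis
      using valid_owner(4,5)[OF e(1), of \<alpha>] e vi' Box.prems(2)
      by (intro Box.IH) (auto intro: sub_modal)
  qed
  then show ?case by simp
qed (simp_all add: tree_def)

lemma tree_satisfiable:
  assumes "holds M s \<phi>"
  shows "satisfiable TYPE(('w, 'a) node) L1 \<phi>"
proof -
  have root: "[] \<in> worlds tree"
    by (simp add: worlds_tree)
  then have "kripke_model tree"
    unfolding kripke_model_def by (auto simp: tree_def simp del: valid.simps)
  then have "model_of L1 tree"
    using tree_cond by (simp add: model_of_def)
  moreover have "holds tree [] \<phi>"
    using assms by (intro tree_truth) (simp_all add: sub_refl)
  ultimately show ?thesis
    unfolding satisfiable_def using root by blast
qed

end

section \<open>Coding nodes in an infinite type, and the equivalence\<close>

lemma node_inj: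
  assumes "infinite (UNIV :: 'w set)"
  shows "\<exists>f :: ('w, 'a::finite) node \<Rightarrow> 'w. inj f"
proof -
  obtain h :: "nat \<Rightarrow> 'w" where h: "inj h"
    using assms infinite_countable_subset by blast
  obtain a :: "'a \<Rightarrow> nat" where a: "inj a"
    using finite_imp_inj_to_nat_seg[of "UNIV :: 'a set"] by auto
  obtain g :: "'w \<times> 'w \<Rightarrow> 'w" where "bij_betw g (UNIV \<times> UNIV) UNIV"
    using card_of_Times_same_infinite[OF assms] card_of_ordIso by blast
  then have g: "g p = g q \<longleftrightarrow> p = q" for p q
    by (auto simp: bij_betw_def dest: injD)
  define c where "c = (\<lambda>(\<alpha>, v, i). g (h (a \<alpha>), g (v, h i)))"
  have c: "c x = c y \<longleftrightarrow> x = y" for x y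
    by (cases x; cases y) (auto simp: c_def g inj_eq[OF h] inj_eq[OF a])
  \<comment> \<open>The end value \<open>undefined\<close> might itself be a code, so injectivity is
    claimed only among lists of equal length, and the length is stored separately.\<close>
  define code where "code xs = foldr (\<lambda>x w. g (c x, w)) xs undefined" for xs
  have code: "code xs = code ys \<Longrightarrow> xs = ys" if "length xs = length ys" for xs ys
    using that by (induction xs ys rule: list_induct2) (auto simp: code_def g c)
  have "inj (\<lambda>xs. g (h (length xs), code xs))"
    using code h by (auto simp: inj_def g)
  then show ?thesis by blast
qed

theorem theorem3p4:
  fixes A :: "'a::finite set"
    and x :: frame_cond
    and L1 L2 :: "'a logic"
    and \<phi> :: "('p::finite, 'a) formula"
    and p :: 'p
  assumes "infinite (UNIV :: 'w set)"
    and "\<And>\<alpha>. \<alpha> \<in> A \<Longrightarrow> L1 \<alpha> = insert x (L2 \<alpha>)"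
    and "\<And>\<alpha>. \<alpha> \<notin> A \<Longrightarrow> L1 \<alpha> = L2 \<alpha>"
    and "\<And>\<alpha> c. c \<in> L2 \<alpha> \<Longrightarrow> precedes c x"
  shows "satisfiable TYPE('w) L1 \<phi> \<longleftrightarrow> satisfiable TYPE('w) L2 (tau p A x \<phi>)"
proof
  assume "satisfiable TYPE('w) L1 \<phi>"
  then obtain M :: "('w, 'a, 'p) kripke" and s
    where M: "model_of L1 M" and s: "s \<in> worlds M" "holds M s \<phi>"
    unfolding satisfiable_def by blast
  have "L2 \<alpha> \<subseteq> L1 \<alpha>" for \<alpha>
    using assms(2,3) by (cases "\<alpha> \<in> A") auto
  then have "model_of L2 M"
    using M unfolding model_of_def by blast
  moreover have "holds M s (tau p A x \<phi>)"
  proof -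
    have closed: "t \<in> worlds M" if "(s, t) \<in> step M ^^ i" for t i
      using that s(1) M by (cases i) (auto simp: step_def acc_def model_of_def kripke_model_def)
    have "holds M t (subst p \<psi> (ax x \<alpha> p))" if "t \<in> worlds M" "\<alpha> \<in> A" for t \<psi> \<alpha>
      using M assms(2)[OF that(2)] that(1) by (intro ax_valid) (auto simp: model_of_def)
    moreover have "finite (sub_bar \<phi> \<times> A)"
      by (intro finite_cartesian_product finite_sub_bar finite)
    ultimately show ?thesis
      using s(2) closed by (auto simp: tau_def holds_Inv holds_Conj)
  qed
  ultimately show "satisfiable TYPE('w) L2 (tau p A x \<phi>)"
    using s(1) unfolding satisfiable_def by blast
next
  assume "satisfiable TYPE('w) L2 (tau p A x \<phi>)"
  then obtain M :: "('w, 'a, 'p) kripke" and s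
    where M: "model_of L2 M" and start: "s \<in> worlds M" "holds M s (tau p A x \<phi>)"
    unfolding satisfiable_def by blast
  interpret reduction M A x L1 L2 \<phi> p
    using M assms by unfold_locales
  \<comment> \<open>The premises stand inside the existential quantifiers so that choice yields
    total functions \<open>E\<close> and \<open>r\<close>.\<close>
  have "\<forall>\<alpha> w m. \<exists>E r. w \<in> worlds M \<longrightarrow> (m > 0 \<longrightarrow> good m w) \<longrightarrow> component \<alpha> w m E r"
    using component_exists by blast
  then obtain E r where
    "\<forall>\<alpha> w m. w \<in> worlds M \<longrightarrow> (m > 0 \<longrightarrow> good m w) \<longrightarrow> component \<alpha> w m (E \<alpha> w m) (r \<alpha> w m)"
    unfolding choice_iff by blast
  then interpret unravelling M A x L1 L2 \<phi> p s E r
    using start tau_good by unfold_locales auto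
  have "satisfiable TYPE(('w, 'a) node) L1 \<phi>"
    using start(2) tau_good by (intro tree_satisfiable) blast
  then show "satisfiable TYPE('w) L1 \<phi>"
    using node_inj[OF assms(1)] satisfiable_inj by blast
qed

end
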